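(* For any Carathéodory hyperbolic domain $\Omega\subset\mathbb{C}^m$, there is a set $\Psi\subset\mathscr{S}(\Omega)$ of test functions on $\Omega$, all vanishing at a common point $w_0\in\Omega$, such that $\mathscr{SA}_\Psi=\mathscr{S}(\Omega)$.
   Context: A domain $\Omega\subset\mathbb{C}^m$ is Carathéodory hyperbolic if the bounded holomorphic functions on $\Omega$ separate the points of $\Omega$. The Schur class $\mathscr{S}(\Omega)$ is the closed unit ball, for the supremum norm, of the Banach algebra of bounded holomorphic functions $\Omega\to\mathbb{C}$. A collection $\Psi$ of $\mathbb{C}$-valued functions on $\Omega$ is a set of test functions if (i) $\sup\{|\psi(z)|:\psi\in\Psi\}<1$ for each $z\in\Omega$; and (ii) for each finite subset $F\subset\Omega$, the restrictions $\{\psi|_F:\psi\in\Psi\}$ together with the constant function generate the algebra of all $\mathbb{C}$-valued functions on $F$. For a function $G:\Omega\times\Omega\to\mathbb{C}$, the notation $(G(z,w))_{z,w\in\Omega}\ge\mathbf{0}$ means $G$ is positive semidefinite: for each finite list $z_1,\dots,z_n\in\Omega$ the matrix $(G(z_i,z_j))_{i,j}$ is positive semidefinite. The set $\mathcal{K}_\Psi$ of $\Psi$-admissible kernels consists of all positive semidefinite functions $k:\Omega\times\Omega\to\mathbb{C}$ such that $\big((1-\psi(z)\overline{\psi(w)})k(z,w)\big)_{z,w\in\Omega}\ge\mathbf{0}$ for all $\psi\in\Psi$. The $\Psi$-Schur-Agler class $\mathscr{SA}_\Psi$ is the set of all functions $f:\Omega\to\mathbb{C}$ such that $\big((1-f(z)\overline{f(w)})k(z,w)\big)_{z,w\in\Omega}\ge\mathbf{0}$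 for all $k\in\mathcal{K}_\Psi$. *)

theory Defs
  imports "HOL-Analysis.Analysis"
begin

text \<open>
  Functions on a set \<open>\<Omega>\<close> are represented by total functions of which only the values on \<open>\<Omega>\<close>
  matter: membership in \<open>H_infinity \<Omega>\<close>, \<open>schur_class \<Omega>\<close>, \<open>admissible_kernels \<Omega> \<Psi>\<close> and
  \<open>schur_agler_class \<Omega> \<Psi>\<close> does not depend on values outside \<open>\<Omega>\<close>, so equalities between these
  sets are equalities of sets of functions on \<open>\<Omega>\<close>.
\<close>

definition domain_in_Cm :: "(complex ^ 'm) set \<Rightarrow> bool" where
  "domain_in_Cm \<Omega> \<longleftrightarrow> open \<Omega> \<and> connected \<Omega> \<and> \<Omega> \<noteq> {}"

text \<open>
  The library's \<^term>\<open>f holomorphic_on S\<close> is restricted to one variable. In several variables a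
  function is holomorphic on an open set if it is complex differentiable at every point, i.e. its
  (real) Frechet derivative exists and is complex linear.
\<close>
definition holomorphic_Cm :: "(complex ^ 'm \<Rightarrow> complex) \<Rightarrow> (complex ^ 'm) set \<Rightarrow> bool" where
  "holomorphic_Cm f \<Omega> \<longleftrightarrow>
     (\<forall>z\<in>\<Omega>. \<exists>D. (f has_derivative D) (at z within \<Omega>) \<and> (\<forall>c v. D (c *s v) = c * D v))"

definition H_infinity :: "(complex ^ 'm) set \<Rightarrow> (complex ^ 'm \<Rightarrow> complex) set" where
  "H_infinity \<Omega> = {f. holomorphic_Cm f \<Omega> \<and> bounded (f ` \<Omega>)}"

definition caratheodory_hyperbolic :: "(complex ^ 'm) set \<Rightarrow> bool" where
  "caratheodory_hyperbolic \<Omega> \<longleftrightarrow>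
     (\<forall>z\<in>\<Omega>. \<forall>w\<in>\<Omega>. z \<noteq> w \<longrightarrow> (\<exists>f\<in>H_infinity \<Omega>. f z \<noteq> f w))"

definition schur_class :: "(complex ^ 'm) set \<Rightarrow> (complex ^ 'm \<Rightarrow> complex) set" where
  "schur_class \<Omega> = {f \<in> H_infinity \<Omega>. (SUP z\<in>\<Omega>. norm (f z)) \<le> 1}"

text \<open>
  The complex algebra of functions on \<open>F\<close> generated by \<open>G\<close>; its elements are extensional
  functions, i.e. undefined outside \<open>F\<close>.
\<close>
inductive_set generated_algebra :: "'a set \<Rightarrow> ('a \<Rightarrow> complex) set \<Rightarrow> ('a \<Rightarrow> complex) set"
  for F :: "'a set" and G :: "('a \<Rightarrow> complex) set" where
  generator: "g \<in> G \<Longrightarrow> restrict g F \<in> generated_algebra F G"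
| add: "\<lbrakk>f \<in> generated_algebra F G; g \<in> generated_algebra F G\<rbrakk>
    \<Longrightarrow> restrict (\<lambda>z. f z + g z) F \<in> generated_algebra F G"
| mult: "\<lbrakk>f \<in> generated_algebra F G; g \<in> generated_algebra F G\<rbrakk>
    \<Longrightarrow> restrict (\<lambda>z. f z * g z) F \<in> generated_algebra F G"
| scale: "f \<in> generated_algebra F G \<Longrightarrow> restrict (\<lambda>z. c * f z) F \<in> generated_algebra F G"

text \<open>The supremum is taken in the extended reals, so that it is meaningful for every \<open>\<Psi>\<close>.\<close>
definition test_functions :: "'a set \<Rightarrow> ('a \<Rightarrow> complex) set \<Rightarrow> bool" where
  "test_functions \<Omega> \<Psi> \<longleftrightarrow>
     (\<forall>z\<in>\<Omega>. (SUP \<psi>\<in>\<Psi>. ereal (norm (\<psi> z))) < 1) \<and>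
     (\<forall>F. finite F \<and> F \<subseteq> \<Omega> \<longrightarrow>
        generated_algebra F (insert (\<lambda>z. 1) \<Psi>) = F \<rightarrow>\<^sub>E (UNIV :: complex set))"

text \<open>
  Since the coefficients are complex, the condition that the quadratic form takes nonnegative real
  values includes that the matrix is Hermitian.
\<close>
definition psd_matrix :: "nat \<Rightarrow> (nat \<Rightarrow> nat \<Rightarrow> complex) \<Rightarrow> bool" where
  "psd_matrix n A \<longleftrightarrow>
     (\<forall>c :: nat \<Rightarrow> complex. (\<Sum>i<n. \<Sum>j<n. cnj (c i) * A i j * c j) \<in> \<real>\<^sub>\<ge>\<^sub>0)"

definition psd_on :: "'a set \<Rightarrow> ('a \<Rightarrow> 'a \<Rightarrow> complex) \<Rightarrow> bool" where
  "psd_on \<Omega> G \<longleftrightarrow>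
     (\<forall>zs. set zs \<subseteq> \<Omega> \<longrightarrow> psd_matrix (length zs) (\<lambda>i j. G (zs ! i) (zs ! j)))"

definition admissible_kernels ::
    "'a set \<Rightarrow> ('a \<Rightarrow> complex) set \<Rightarrow> ('a \<Rightarrow> 'a \<Rightarrow> complex) set" where
  "admissible_kernels \<Omega> \<Psi> =
     {k. psd_on \<Omega> k \<and> (\<forall>\<psi>\<in>\<Psi>. psd_on \<Omega> (\<lambda>z w. (1 - \<psi> z * cnj (\<psi> w)) * k z w))}"

definition schur_agler_class :: "'a set \<Rightarrow> ('a \<Rightarrow> complex) set \<Rightarrow> ('a \<Rightarrow> complex) set" where
  "schur_agler_class \<Omega> \<Psi> =
     {f. \<forall>k\<in>admissible_kernels \<Omega> \<Psi>. psd_on \<Omega> (\<lambda>z w. (1 - f z * cnj (f w)) * k z w)}"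

end

theory Submission
  imports Defs "HOL-Complex_Analysis.Complex_Analysis"
begin

text \<open>
  Take for \<open>\<Psi>\<close> all functions of the Schur class that vanish at a fixed base point \<open>w\<close>. Everything
  rests on the positivity of Pick's kernel \<open>(1 - g z * cnj (g w)) / (1 - z * cnj w)\<close> for a
  holomorphic \<open>g\<close> bounded by 1 on the unit disc (\<open>psd_on_pick_kernel\<close>), used along affine discs in the
  domain, and on its converse.

  \<^item> Test functions. Caratheodory hyperbolicity lets the class separate points, so that products of
    differences give all functions on a finite set. The Pick matrix at two points shows that if
    all functions of the class stay a fixed distance away from the unit circle at one point, they do so
    at nearby points; connectedness carries this from \<open>w\<close> to every point
    (\<open>based_schur_class_uniform_bound\<close>).

  \<^item> The Schur class is contained in the Schur-Agler class. A disc automorphism moves \<open>f w\<close> to 0 and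
    turns \<open>f\<close> into a test function \<open>\<phi>\<close>; the kernels \<open>1 - f z * cnj (f z')\<close> and
    \<open>1 - \<phi> z * cnj (\<phi> z')\<close> differ by a congruence.
    This works if \<open>f\<close> is strictly bounded by 1, and the general case is a limit.

  \<^item> The Schur-Agler class is contained in the Schur class. A few explicit admissible kernels
    already force this. The diagonal kernel gives the bound
    \<open>norm (f z) \<le> 1\<close>. The Szego kernel of an affine disc, extended by zero, is admissible
    and yields that \<open>f\<close> restricted to the disc has a positive Pick kernel
    (\<open>schur_agler_class_pick_on_line\<close>). Read at the three points \<open>0, s, t\<close>, this says that the difference
    quotients at the centre differ by at most \<open>2 * (norm s + norm t)\<close>, so \<open>f\<close> is complex
    differentiable along every complex line, with a uniform remainder. An argument in the style of
    Osgood's lemma, with the Lipschitz bound from two points, then gives a complex linear Frechet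
    derivative.
\<close>

section \<open>Positive semidefinite kernels\<close>

lemma psd_onD:
  assumes "psd_on S G" "set zs \<subseteq> S"
  shows "(\<Sum>i<length zs. \<Sum>j<length zs. cnj (c i) * G (zs!i) (zs!j) * c j) \<in> \<real>\<^sub>\<ge>\<^sub>0"
  using assms unfolding psd_on_def psd_matrix_def by blast

lemma psd_onI:
  assumes "\<And>zs c. set zs \<subseteq> S \<Longrightarrow>
    (\<Sum>i<length zs. \<Sum>j<length zs. cnj (c i) * G (zs!i) (zs!j) * c j) \<in> \<real>\<^sub>\<ge>\<^sub>0"
  shows "psd_on S G"
  using assms unfolding psd_on_def psd_matrix_def by blast

lemma psd_on_cong:
  assumes "\<And>z w. z \<in> S \<Longrightarrow> w \<in> S \<Longrightarrow> G z w = G' z w"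
  shows "psd_on S G \<longleftrightarrow> psd_on S G'"
proof -
  have "psd_matrix (length zs) (\<lambda>i j. G (zs!i) (zs!j)) = psd_matrix (length zs) (\<lambda>i j. G' (zs!i) (zs!j))"
    if "set zs \<subseteq> S" for zs
    unfolding psd_matrix_def
    using that by (intro all_cong1 arg_cong[where f = "\<lambda>x. x \<in> \<real>\<^sub>\<ge>\<^sub>0"] sum.cong refl)
      (auto intro!: assms simp: subset_iff)
  then show ?thesis
    unfolding psd_on_def by blast
qed

lemma psd_on_add:
  assumes "psd_on S G" "psd_on S G'"
  shows "psd_on S (\<lambda>z w. G z w + G' z w)"
proof (rule psd_onI)
  fix zs and c :: "nat \<Rightarrow> complex"
  assume "set zs \<subseteq> S"
  from nonneg_Reals_add_I[OF psd_onD[OF assms(1) this] psd_onD[OF assms(2) this]]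
  show "(\<Sum>i<length zs. \<Sum>j<length zs. cnj (c i) * (G (zs!i) (zs!j) + G' (zs!i) (zs!j)) * c j) \<in> \<real>\<^sub>\<ge>\<^sub>0"
    by (simp add: sum.distrib[symmetric] algebra_simps)
qed

text \<open>
  The quadratic form of the new kernel at the points \<open>z\<^sub>i\<close> is that of the old one at the points
  \<open>p z\<^sub>i\<close>, with the coefficient \<open>c\<^sub>i\<close> replaced by \<open>cnj (m z\<^sub>i) * c\<^sub>i\<close>. If \<open>m\<close> is an indicator function,
  this extends a kernel by zero.
\<close>
lemma psd_on_pullback_congruence:
  assumes "psd_on S G" "p ` T \<subseteq> S"
  shows "psd_on T (\<lambda>z w. m z * G (p z) (p w) * cnj (m w))"
proof (rule psd_onI)
  fix zs and c :: "nat \<Rightarrow> complex"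
  assume "set zs \<subseteq> T"
  then have "set (map p zs) \<subseteq> S"
    using assms(2) by auto
  from psd_onD[OF assms(1) this, of "\<lambda>i. cnj (m (zs!i)) * c i"]
  show "(\<Sum>i<length zs. \<Sum>j<length zs.
      cnj (c i) * (m (zs!i) * G (p (zs!i)) (p (zs!j)) * cnj (m (zs!j))) * c j) \<in> \<real>\<^sub>\<ge>\<^sub>0"
    by (simp add: algebra_simps)
qed

lemma psd_on_diagonal:
  assumes "\<And>z. z \<in> S \<Longrightarrow> d z \<ge> 0"
  shows "psd_on S (\<lambda>z w. if z = w then complex_of_real (d z) else 0)"
proof (rule psd_onI)
  fix zs and c :: "nat \<Rightarrow> complex"
  assume zs: "set zs \<subseteq> S"
  let ?n = "length zs"
  \<comment> \<open>A point may occur several times in the list, so the terms are grouped by the points.\<close>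
  define e where "e x = (\<Sum>i<?n. if zs!i = x then c i else 0)" for x
  have "(\<Sum>i<?n. \<Sum>j<?n. cnj (c i) * (if zs!i = zs!j then complex_of_real (d (zs!i)) else 0) * c j)
      = (\<Sum>i<?n. \<Sum>j<?n. \<Sum>x\<in>set zs. of_real (d x) *
          (cnj (if zs!i = x then c i else 0) * (if zs!j = x then c j else 0)))"
  proof (intro sum.cong refl)
    fix i j assume "i \<in> {..<?n}" "j \<in> {..<?n}"
    then have "zs!i \<in> set zs" by simp
    have "(\<Sum>x\<in>set zs. of_real (d x) *
          (cnj (if zs!i = x then c i else 0) * (if zs!j = x then c j else 0)))
       = (\<Sum>x\<in>set zs. if zs!i = x then of_real (d x) * (cnj (c i) * (if zs!j = x then c j else 0)) else 0)"
      by (intro sum.cong) auto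
    also have "\<dots> = of_real (d (zs!i)) * (cnj (c i) * (if zs!j = zs!i then c j else 0))"
      using \<open>zs!i \<in> set zs\<close> by simp
    finally show "cnj (c i) * (if zs!i = zs!j then complex_of_real (d (zs!i)) else 0) * c j =
       (\<Sum>x\<in>set zs. of_real (d x) *
          (cnj (if zs!i = x then c i else 0) * (if zs!j = x then c j else 0)))"
      by auto
  qed
  also have "\<dots> = (\<Sum>x\<in>set zs. \<Sum>i<?n. \<Sum>j<?n. of_real (d x) *
          (cnj (if zs!i = x then c i else 0) * (if zs!j = x then c j else 0)))"
    by (simp only: sum.swap[of _ "{..<?n}" "set zs"])
  also have "\<dots> = (\<Sum>x\<in>set zs. of_real (d x) * (cnj (e x) * e x))"
    by (simp only: e_def cnj_sum sum_product) (simp only: sum_distrib_left)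
  also have "\<dots> = of_real (\<Sum>x\<in>set zs. d x * (norm (e x))\<^sup>2)"
    by (simp only: of_real_sum of_real_mult complex_norm_square mult.commute)
  also have "\<dots> \<in> \<real>\<^sub>\<ge>\<^sub>0"
    unfolding nonneg_Reals_of_real_iff
    using zs assms by (intro sum_nonneg mult_nonneg_nonneg) auto
  finally show "(\<Sum>i<?n. \<Sum>j<?n. cnj (c i) *
      (if zs!i = zs!j then complex_of_real (d (zs!i)) else 0) * c j) \<in> \<real>\<^sub>\<ge>\<^sub>0" .
qed

section \<open>The Pick kernel of a Schur function on the disc\<close>

lemma one_minus_mult_cnj_nonzero:
  fixes z w :: complex
  assumes "norm z \<le> 1" "norm w < 1"
  shows "1 - z * cnj w \<noteq> 0"
proof
  assume "1 - z * cnj w = 0"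
  then have "norm (z * cnj w) = 1" by simp
  moreover have "norm z * norm w \<le> 1 * norm w"
    using assms by (intro mult_right_mono) auto
  ultimately show False
    using assms by (simp add: norm_mult)
qed

definition szego :: "complex \<Rightarrow> complex \<Rightarrow> complex" where
  "szego z w = 1 / (1 - z * cnj w)"

definition pick_kernel :: "(complex \<Rightarrow> complex) \<Rightarrow> complex \<Rightarrow> complex \<Rightarrow> complex" where
  "pick_kernel g z w = (1 - g z * cnj (g w)) * szego z w"

text \<open>
  Cauchy's formula: in the mean over the unit circle, where \<open>cnj \<zeta> = 1 / \<zeta>\<close>, pairing with the
  Szego kernel at \<open>w\<close> evaluates at \<open>w\<close>.
\<close>
lemma szego_reproducing:
  assumes "u holomorphic_on cball 0 1" "norm w < 1"
  shows "((\<lambda>t. u (exp (2 * of_real pi * \<i> * of_real t)) *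
            cnj (szego (exp (2 * of_real pi * \<i> * of_real t)) w)) has_integral u w) {0..1}"
proof -
  have "((\<lambda>\<zeta>. u \<zeta> / (\<zeta> - w)) has_contour_integral (2 * of_real pi * \<i> * u w)) (circlepath 0 1)"
    using assms by (intro Cauchy_integral_circlepath holomorphic_on_imp_continuous_on)
      (auto intro: holomorphic_on_subset)
  then have "((\<lambda>t. 1 / (2 * of_real pi * \<i>) * (u (circlepath 0 1 t) / (circlepath 0 1 t - w) *
      vector_derivative (circlepath 0 1) (at t))) has_integral
      1 / (2 * of_real pi * \<i>) * (2 * of_real pi * \<i> * u w)) {0..1}"
    unfolding has_contour_integral by (rule has_integral_mult_right)
  then have *: "((\<lambda>t. 1 / (2 * of_real pi * \<i>) * (u (circlepath 0 1 t) / (circlepath 0 1 t - w) *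
      vector_derivative (circlepath 0 1) (at t))) has_integral u w) {0..1}"
    by simp
  show ?thesis
  proof (rule has_integral_eq[OF _ *])
    fix t :: real
    let ?e = "exp (2 * of_real pi * \<i> * of_real t)"
    have n: "norm ?e = 1" by simp
    then have c: "?e * cnj ?e = 1"
      by (metis complex_norm_square of_real_1 power_one)
    then have d: "?e - w = ?e * (1 - w * cnj ?e)"
      by (simp add: algebra_simps)
    have "1 - w * cnj ?e \<noteq> 0"
      using one_minus_mult_cnj_nonzero[of ?e w] n assms(2)
      by (metis complex_cnj_cnj complex_cnj_diff complex_cnj_mult complex_cnj_one complex_cnj_zero mult.commute order_refl)
    then show "1 / (2 * of_real pi * \<i>) * (u (circlepath 0 1 t) / (circlepath 0 1 t - w) *
      vector_derivative (circlepath 0 1) (at t)) = u ?e * cnj (szego ?e w)"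
      unfolding vector_derivative_circlepath
      unfolding circlepath szego_def by (simp add: d)
  qed
qed

text \<open>
  Given points \<open>w\<^sub>i\<close> and coefficients \<open>c\<^sub>i\<close>, let \<open>G\<close> be the sum of the \<open>c\<^sub>i * szego _ w\<^sub>i\<close> and let \<open>H\<close> be
  its image under the adjoint of multiplication by \<open>g\<close>. The quadratic form of the Pick kernel is
  the mean over the circle of \<open>\<bar>G\<bar>\<^sup>2 - \<bar>H\<bar>\<^sup>2\<close>, and since \<open>g H\<close> paired with \<open>G\<close> gives the mean of
  \<open>\<bar>H\<bar>\<^sup>2\<close>, this is also the mean of \<open>\<bar>G - g H\<bar>\<^sup>2 + (1 - \<bar>g\<bar>\<^sup>2) \<bar>H\<bar>\<^sup>2\<close>, a nonnegative function.
\<close>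
lemma psd_on_pick_kernel:
  assumes hol: "g holomorphic_on cball 0 1"
    and bound: "\<And>z. norm z \<le> 1 \<Longrightarrow> norm (g z) \<le> 1"
  shows "psd_on (ball 0 1) (pick_kernel g)"
proof (rule psd_onI)
  fix zs :: "complex list" and c :: "nat \<Rightarrow> complex"
  assume "set zs \<subseteq> ball 0 1"
  define n where "n = length zs"
  define w where "w i = zs ! i" for i
  have w: "norm (w i) < 1" if "i < n" for i
    using \<open>set zs \<subseteq> ball 0 1\<close> that by (auto simp: n_def w_def subset_iff)
  define e where "e t = exp (2 * of_real pi * \<i> * complex_of_real t)" for t
  have norm_e: "norm (e t) = 1" for t
    by (simp add: e_def)
  define comb where "comb a z = (\<Sum>i<n. a i * szego z (w i))" for a :: "nat \<Rightarrow> complex" and z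
  have comb_hol: "comb a holomorphic_on cball 0 1" for a
    unfolding comb_def szego_def
    by (intro holomorphic_intros one_minus_mult_cnj_nonzero) (simp_all add: w)
  have pair: "((\<lambda>t. u (e t) * cnj (comb a (e t))) has_integral (\<Sum>i<n. cnj (a i) * u (w i))) {0..1}"
    if "u holomorphic_on cball 0 1" for u a
  proof -
    have "((\<lambda>t. \<Sum>i<n. cnj (a i) * (u (e t) * cnj (szego (e t) (w i)))) has_integral
        (\<Sum>i<n. cnj (a i) * u (w i))) {0..1}"
      unfolding e_def
      by (intro has_integral_sum has_integral_mult_right szego_reproducing that) (auto intro: w)
    then show ?thesis
      by (simp add: comb_def sum_distrib_left algebra_simps)
  qed
  define G where "G = comb c"
  define b where "b i = c i * cnj (g (w i))" for i
  define H where "H = comb b"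
  define B where "B = (\<Sum>i<n. cnj (b i) * H (w i))"
  have GG: "((\<lambda>t. G (e t) * cnj (G (e t))) has_integral (\<Sum>i<n. cnj (c i) * G (w i))) {0..1}"
    unfolding G_def by (intro pair comb_hol)
  have HH: "((\<lambda>t. H (e t) * cnj (H (e t))) has_integral B) {0..1}"
    unfolding H_def B_def by (intro pair comb_hol)
  have "((\<lambda>t. g (e t) * H (e t) * cnj (G (e t))) has_integral (\<Sum>i<n. cnj (c i) * (g (w i) * H (w i)))) {0..1}"
    unfolding H_def G_def by (intro pair comb_hol holomorphic_intros hol)
  then have HG: "((\<lambda>t. g (e t) * H (e t) * cnj (G (e t))) has_integral B) {0..1}"
    by (simp add: B_def b_def algebra_simps)
  have "((\<lambda>t. H (e t) * cnj (H (e t))) has_integral cnj B) {0..1}"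
    using has_integral_cnj[THEN iffD2, OF HH] by (simp add: o_def mult.commute)
  then have B_real: "cnj B = B"
    using HH by (rule has_integral_unique)
  define p where "p t = (norm (G (e t) - g (e t) * H (e t)))\<^sup>2
      + (1 - (norm (g (e t)))\<^sup>2) * (norm (H (e t)))\<^sup>2" for t
  have "p t \<ge> 0" for t
    unfolding p_def using bound[of "e t"] norm_e[of t]
    by (intro add_nonneg_nonneg mult_nonneg_nonneg) (simp_all add: power_le_one)
  have "((\<lambda>t. G (e t) * cnj (G (e t)) - g (e t) * H (e t) * cnj (G (e t))
        - cnj (g (e t) * H (e t) * cnj (G (e t))) + H (e t) * cnj (H (e t))) has_integral
        ((\<Sum>i<n. cnj (c i) * G (w i)) - B - cnj B + B)) {0..1}"
    by (intro has_integral_add has_integral_diff GG HG HH has_integral_cnj[THEN iffD2, OF HG, unfolded o_def])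
  moreover have "G (e t) * cnj (G (e t)) - g (e t) * H (e t) * cnj (G (e t))
        - cnj (g (e t) * H (e t) * cnj (G (e t))) + H (e t) * cnj (H (e t)) = of_real (p t)" for t
    unfolding p_def of_real_add of_real_mult of_real_diff complex_norm_square of_real_1
    by (simp add: algebra_simps)
  ultimately have int: "((\<lambda>t. complex_of_real (p t)) has_integral
        ((\<Sum>i<n. cnj (c i) * G (w i)) - B)) {0..1}"
    by (simp add: B_real)
  have "(\<Sum>i<n. cnj (c i) * G (w i)) - B =
      (\<Sum>i<n. \<Sum>j<n. cnj (c i) * pick_kernel g (w i) (w j) * c j)"
    unfolding B_def G_def H_def comb_def pick_kernel_def b_def
    by (simp add: sum_subtractf[symmetric] sum_distrib_left algebra_simps)
  moreover have "(\<Sum>i<n. cnj (c i) * G (w i)) - B \<in> \<real>\<^sub>\<ge>\<^sub>0"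
  proof -
    have "(p has_integral Re ((\<Sum>i<n. cnj (c i) * G (w i)) - B)) {0..1}"
      using has_integral_linear[OF int bounded_linear_Re] by (simp add: o_def)
    then have "Re ((\<Sum>i<n. cnj (c i) * G (w i)) - B) \<ge> 0"
      by (rule has_integral_nonneg) (simp add: \<open>\<And>t. p t \<ge> 0\<close>)
    moreover have "((\<lambda>t. 0::real) has_integral Im ((\<Sum>i<n. cnj (c i) * G (w i)) - B)) {0..1}"
      using has_integral_linear[OF int bounded_linear_Im] by (simp add: o_def)
    then have "Im ((\<Sum>i<n. cnj (c i) * G (w i)) - B) = 0"
      by (metis has_integral_0_eq)
    ultimately show ?thesis
      by (simp add: complex_nonneg_Reals_iff)
  qed
  ultimately show "(\<Sum>i<length zs. \<Sum>j<length zs. cnj (c i) * pick_kernel g (zs!i) (zs!j) * c j) \<in> \<real>\<^sub>\<ge>\<^sub>0"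
    by (simp add: n_def w_def)
qed

lemma psd_on_szego: "psd_on (ball 0 1) szego"
  using psd_on_pick_kernel[of "\<lambda>_. 0"] by (simp add: pick_kernel_def[abs_def])

text \<open>
  If multiplication by \<open>g\<close> is contractive on the Hardy space, then \<open>g\<close> itself, the image of the
  constant 1, is in the unit ball. In terms of kernels: the kernel here exceeds the Pick kernel by
  \<open>g z * (szego z w - 1) * cnj (g w)\<close>, and \<open>szego z w - 1 = z * szego z w * cnj w\<close>.
\<close>
lemma psd_on_szego_minus_product:
  assumes "psd_on (ball 0 1) (pick_kernel g)"
  shows "psd_on (ball 0 1) (\<lambda>z w. szego z w - g z * cnj (g w))"
proof -
  have "psd_on (ball 0 1) (\<lambda>z w. pick_kernel g z w + (g z * z) * szego z w * cnj (g w * w))"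
    using psd_on_pullback_congruence[OF psd_on_szego, where m = "\<lambda>z. g z * z" and p = "\<lambda>z. z" and T = "ball 0 1"]
    by (intro psd_on_add assms) auto
  also have "?this \<longleftrightarrow> ?thesis"
  proof (rule psd_on_cong)
    fix z w :: complex
    assume "z \<in> ball 0 1" "w \<in> ball 0 1"
    then have "1 - z * cnj w \<noteq> 0"
      by (intro one_minus_mult_cnj_nonzero) auto
    then have "szego z w * (1 - z * cnj w) = 1"
      by (simp add: szego_def)
    then show "pick_kernel g z w + (g z * z) * szego z w * cnj (g w * w) = szego z w - g z * cnj (g w)"
      unfolding pick_kernel_def complex_cnj_mult by algebra
  qed
  finally show ?thesis .
qed

section \<open>Bounds from the Pick kernel at two and three points\<close>

lemma norm_szego_minus_one_le:
  assumes "norm z \<le> 1/2" "norm w \<le> 1/2"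
  shows "norm (szego z w - 1) \<le> 2 * norm z * norm w"
proof -
  have nz: "1 - z * cnj w \<noteq> 0"
    using assms by (intro one_minus_mult_cnj_nonzero) auto
  have "norm z * norm w \<le> 1/2 * (1/2)"
    using assms by (intro mult_mono) auto
  then have le: "1/2 \<le> norm (1 - z * cnj w)"
    using norm_triangle_ineq2[of 1 "z * cnj w"] by (simp add: norm_mult)
  have "szego z w - 1 = z * cnj w / (1 - z * cnj w)"
    using nz by (simp add: szego_def divide_simps)
  then have "norm (szego z w - 1) = norm z * norm w / norm (1 - z * cnj w)"
    by (simp add: norm_divide norm_mult)
  also have "\<dots> \<le> norm z * norm w / (1/2)"
    using le by (intro divide_left_mono) auto
  finally show ?thesis by simp
qed

lemma norm_power2_le_of_diff_nonneg:
  assumes "X - Q * cnj Q \<in> \<real>\<^sub>\<ge>\<^sub>0"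
  shows "(norm Q)\<^sup>2 \<le> norm X"
proof -
  have "0 \<le> Re X - (norm Q)\<^sup>2"
    using assms unfolding complex_norm_square[symmetric] by (simp add: complex_nonneg_Reals_iff)
  also have "Re X \<le> norm X"
    by (rule complex_Re_le_cmod)
  finally show ?thesis by simp
qed

text \<open>
  The difference of the evaluations at \<open>s\<close> and 0 has norm \<open>O(s)\<close> on the Hardy space.
\<close>
lemma pick_two_point_bound:
  assumes "psd_on (ball 0 1) (pick_kernel g)" "norm s \<le> 1/2"
  shows "norm (g s - g 0) \<le> 2 * norm s"
proof -
  have "(szego s s - 1) - (g s - g 0) * cnj (g s - g 0) \<in> \<real>\<^sub>\<ge>\<^sub>0"
    using psd_onD[OF psd_on_szego_minus_product[OF assms(1)], of "[0, s]" "\<lambda>i. if i = 0 then -1 else 1"] assms(2)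
    by (simp add: numeral_2_eq_2 szego_def algebra_simps)
  then have "(norm (g s - g 0))\<^sup>2 \<le> norm (szego s s - 1)"
    by (rule norm_power2_le_of_diff_nonneg)
  also have "\<dots> \<le> 2 * (norm s)\<^sup>2"
    using norm_szego_minus_one_le[OF assms(2) assms(2)] by (simp add: power2_eq_square)
  also have "\<dots> \<le> (2 * norm s)\<^sup>2"
    by (simp add: power_mult_distrib)
  finally show ?thesis
    by (rule power2_le_imp_le) simp
qed

text \<open>
  A difference of difference quotients at 0 annihilates the functions \<open>1\<close> and \<open>z\<close>, so its norm on the
  Hardy space is small of first order; the kernel inequality bounds its value at \<open>g\<close> by that norm.
\<close>
lemma pick_three_point_bound:
  assumes psd: "psd_on (ball 0 1) (pick_kernel g)"
    and s: "norm s \<le> 1/2" "s \<noteq> 0" and t: "norm t \<le> 1/2" "t \<noteq> 0"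
  shows "norm ((g s - g 0) / s - (g t - g 0) / t) \<le> 2 * (norm s + norm t)"
proof -
  define Q where "Q = (g s - g 0) / s - (g t - g 0) / t"
  define X where "X = szego s s - szego s t - szego t s + szego t t"
  have expand: "szego z w = 1 + z * cnj w * szego z w" if "norm z \<le> 1/2" "norm w \<le> 1/2" for z w
  proof -
    have "1 - z * cnj w \<noteq> 0"
      using that by (intro one_minus_mult_cnj_nonzero) auto
    then show ?thesis
      by (simp add: szego_def divide_simps)
  qed
  define a b where "a = 1 / s" and "b = 1 / t"
  have ab: "a * s = 1" "b * t = 1" "cnj a * cnj s = 1" "cnj b * cnj t = 1"
    using s t by (auto simp: a_def b_def)
  have form: "(b - a) * cnj (b - a) + (b - a) * cnj a - (b - a) * cnj b + a * cnj (b - a) - b * cnj (b - a)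
      + a * cnj a * szego s s - a * cnj b * szego s t - b * cnj a * szego t s + b * cnj b * szego t t
      = X"
  proof -
    have "a * cnj a * szego s s = a * cnj a + szego s s"
      using expand[OF s(1) s(1)] ab by algebra
    moreover have "a * cnj b * szego s t = a * cnj b + szego s t"
      using expand[OF s(1) t(1)] ab by algebra
    moreover have "b * cnj a * szego t s = b * cnj a + szego t s"
      using expand[OF t(1) s(1)] ab by algebra
    moreover have "b * cnj b * szego t t = b * cnj b + szego t t"
      using expand[OF t(1) t(1)] ab by algebra
    ultimately show ?thesis
      by (simp add: X_def algebra_simps)
  qed
  have Q: "Q = (b - a) * g 0 + a * g s - b * g t"
    using s t by (simp add: Q_def a_def b_def field_simps)
  \<comment> \<open>The coefficients of the values at 0, s and t in the difference of difference quotients, up to conjugation.\<close>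
  define c where "c i = cnj ([b - a, a, - b] ! i)" for i
  have "(\<Sum>i<3. \<Sum>j<3. cnj (c i) * (szego ([0,s,t]!i) ([0,s,t]!j) - g ([0,s,t]!i) * cnj (g ([0,s,t]!j))) * c j) \<in> \<real>\<^sub>\<ge>\<^sub>0"
    using psd_onD[OF psd_on_szego_minus_product[OF psd], of "[0, s, t]" c] s t
    by (simp add: numeral_3_eq_3)
  also have "(\<Sum>i<3. \<Sum>j<3. cnj (c i) * (szego ([0,s,t]!i) ([0,s,t]!j) - g ([0,s,t]!i) * cnj (g ([0,s,t]!j))) * c j)
     = X - Q * cnj Q"
    unfolding form[symmetric] Q
    by (simp add: c_def numeral_3_eq_3 szego_def[of 0] szego_def[of _ 0] algebra_simps)
  finally have "(norm Q)\<^sup>2 \<le> norm X"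
    by (rule norm_power2_le_of_diff_nonneg)
  also have "X = (szego s s - 1) - (szego s t - 1) - (szego t s - 1) + (szego t t - 1)"
    by (simp add: X_def)
  also have "norm \<dots> \<le> norm (szego s s - 1) + norm (szego s t - 1) + norm (szego t s - 1) + norm (szego t t - 1)"
    by (meson add_mono norm_triangle_le norm_triangle_le_diff order_refl)
  also have "\<dots> \<le> 2 * norm s * norm s + 2 * norm s * norm t + 2 * norm t * norm s + 2 * norm t * norm t"
    using s t by (intro add_mono norm_szego_minus_one_le)
  also have "\<dots> = 2 * (norm s + norm t)\<^sup>2"
    by (simp add: power2_eq_square algebra_simps)
  also have "\<dots> \<le> (2 * (norm s + norm t))\<^sup>2"
    unfolding power_mult_distrib by (intro mult_right_mono) auto
  finally show ?thesis
    unfolding Q_def by (rule power2_le_imp_le) auto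
qed

text \<open>
  By the three-point bound the difference quotients form a Cauchy family; letting one of the two
  points tend to 0 turns the bound into an estimate of the remainder.
\<close>
lemma pick_imp_differentiable_at_0:
  assumes psd: "psd_on (ball 0 1) (pick_kernel g)"
  obtains D where "\<And>s. norm s \<le> 1/2 \<Longrightarrow> norm (g s - g 0 - s * D) \<le> 2 * (norm s)\<^sup>2"
proof -
  define q where "q s = (g s - g 0) / s" for s
  define t where "t n = complex_of_real (inverse (real (Suc (Suc n))))" for n
  have norm_t: "norm (t n) = inverse (real (Suc (Suc n)))" for n
    unfolding t_def norm_of_real by simp
  have t: "norm (t n) \<le> 1/2" "t n \<noteq> 0" for n
  proof -
    show "norm (t n) \<le> 1/2"
      unfolding norm_t by (simp add: field_simps)
    show "t n \<noteq> 0"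
      using norm_t[of n] by auto
  qed
  have t_lim: "(\<lambda>n. norm (t n)) \<longlonglongrightarrow> 0"
    unfolding norm_t
    by (rule LIMSEQ_Suc[OF LIMSEQ_inverse_real_of_nat])
  have q_bound: "norm (q s - q (t n)) \<le> 2 * (norm s + norm (t n))" if "norm s \<le> 1/2" "s \<noteq> 0" for s n
    unfolding q_def by (rule pick_three_point_bound[OF psd that t])
  have "Cauchy (\<lambda>n. q (t n))"
  proof (rule metric_CauchyI)
    fix e :: real assume "e > 0"
    then have "\<forall>\<^sub>F n in sequentially. norm (t n) < e / 4"
      using order_tendstoD(2)[OF t_lim, of "e/4"] by simp
    then obtain N where N: "\<And>n. n \<ge> N \<Longrightarrow> norm (t n) < e / 4"
      unfolding eventually_sequentially by blast
    have "dist (q (t m)) (q (t n)) < e" if "m \<ge> N" "n \<ge> N" for m n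
      using q_bound[of "t m" n] t[of m] N[OF that(1)] N[OF that(2)] by (simp add: dist_norm)
    then show "\<exists>M. \<forall>m\<ge>M. \<forall>n\<ge>M. dist (q (t m)) (q (t n)) < e" by blast
  qed
  then obtain D where D: "(\<lambda>n. q (t n)) \<longlonglongrightarrow> D"
    using Cauchy_convergent convergent_def by blast
  show thesis
  proof (rule that)
    fix s :: complex assume s: "norm s \<le> 1/2"
    show "norm (g s - g 0 - s * D) \<le> 2 * (norm s)\<^sup>2"
    proof (cases "s = 0")
      case False
      have "norm (q s - D) \<le> 2 * (norm s + 0)"
      proof (rule LIMSEQ_le)
        show "(\<lambda>n. norm (q s - q (t n))) \<longlonglongrightarrow> norm (q s - D)"
          by (intro tendsto_intros D)
        show "(\<lambda>n. 2 * (norm s + norm (t n))) \<longlonglongrightarrow> 2 * (norm s + 0)"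
          by (intro tendsto_intros t_lim)
      qed (use q_bound[OF s False] in blast)
      moreover have "g s - g 0 - s * D = s * (q s - D)"
        using False by (simp add: q_def field_simps)
      ultimately show ?thesis
        by (simp add: norm_mult power2_eq_square mult_left_mono mult.left_commute)
    qed auto
  qed
qed

lemma holomorphic_bounded_increment:
  assumes "g holomorphic_on cball 0 1" "M > 0" "\<And>z. norm z \<le> 1 \<Longrightarrow> norm (g z) \<le> M" "norm s \<le> 1/2"
  shows "norm (g s - g 0) \<le> 2 * M * norm s"
proof -
  have "psd_on (ball 0 1) (pick_kernel (\<lambda>z. g z / of_real M))"
    using assms by (intro psd_on_pick_kernel holomorphic_intros) (auto simp: norm_divide)
  from pick_two_point_bound[OF this assms(4)]
  have "norm ((g s - g 0) / of_real M) \<le> 2 * norm s"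
    by (simp add: diff_divide_distrib)
  with \<open>M > 0\<close> show ?thesis
    by (simp add: norm_divide field_simps)
qed

text \<open>
  The determinant of the Pick matrix at 0 and \<open>z\<close> is nonnegative, which bounds
  \<open>(1 - \<bar>g 0\<bar>)\<^sup>2 \<le> \<bar>1 - g 0 * cnj (g z)\<bar>\<^sup>2\<close> by the product of the diagonal entries.
\<close>
lemma holomorphic_schwarz_pick_distance_to_circle:
  assumes hol: "g holomorphic_on cball 0 1" and bound: "\<And>z. norm z \<le> 1 \<Longrightarrow> norm (g z) \<le> 1"
    and z: "norm z \<le> 1/2"
  shows "1 - norm (g 0) \<le> 8 * (1 - norm (g z))"
proof (cases "norm (g 0) = 1")
  case True
  then show ?thesis using bound[of z] z by simp
next
  case False
  define x y where "x = norm (g 0)" and "y = norm (g z)"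
  have x: "0 \<le> x" "x < 1" and y: "0 \<le> y" "y \<le> 1"
    using False bound[of 0] bound[of z] z by (auto simp: x_def y_def)
  define B where "B = 1 - g 0 * cnj (g z)"
  define A where "A = 1 - x\<^sup>2"
  define C where "C = (1 - y\<^sup>2) / (1 - (norm z)\<^sup>2)"
  have "A > 0" using x by (simp add: A_def power_less_one_iff abs_square_less_1)
  have A: "pick_kernel g 0 0 = of_real A"
    by (simp add: pick_kernel_def szego_def A_def x_def complex_norm_square[symmetric])
  have C: "pick_kernel g z z = of_real C"
    by (simp add: pick_kernel_def szego_def C_def y_def complex_norm_square[symmetric])
  have B: "pick_kernel g 0 z = B" "pick_kernel g z 0 = cnj B"
    by (auto simp: pick_kernel_def szego_def B_def mult.commute)
  have "complex_of_real (A * (A * C - (norm B)\<^sup>2)) \<in> \<real>\<^sub>\<ge>\<^sub>0"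
  proof -
    \<comment> \<open>The vector (-B, A) is the one on which the form is the first entry times the determinant.\<close>
    have "(\<Sum>i<2. \<Sum>j<2. cnj (if i = 0 then - B else of_real A) * pick_kernel g ([0,z]!i) ([0,z]!j) *
        (if j = 0 then - B else of_real A)) \<in> \<real>\<^sub>\<ge>\<^sub>0"
      using psd_onD[OF psd_on_pick_kernel[OF hol bound], of "[0,z]" "\<lambda>i. if i = 0 then - B else of_real A"] z
      by (simp add: numeral_2_eq_2)
    also have "(\<Sum>i<2. \<Sum>j<2. cnj (if i = (0::nat) then - B else of_real A) * pick_kernel g ([0,z]!i) ([0,z]!j) *
        (if j = (0::nat) then - B else of_real A)) = of_real (A * (A * C - (norm B)\<^sup>2))"
      unfolding of_real_mult of_real_diff complex_norm_square
      by (simp add: numeral_2_eq_2 A B C algebra_simps)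
    finally show ?thesis .
  qed
  then have AC: "(norm B)\<^sup>2 \<le> A * C"
    using \<open>A > 0\<close> unfolding nonneg_Reals_of_real_iff by (simp add: zero_le_mult_iff)
  have "1 - x \<le> norm B"
  proof -
    have "norm (g 0 * cnj (g z)) \<le> x * 1"
      unfolding norm_mult x_def using y by (intro mult_mono) (auto simp: y_def)
    then show ?thesis
      using norm_triangle_ineq2[of 1 "g 0 * cnj (g z)"] by (simp add: B_def)
  qed
  then have "(1 - x)\<^sup>2 \<le> (norm B)\<^sup>2"
    using x by (intro power_mono) auto
  also note AC
  also have "A * C \<le> (2 * (1 - x)) * (4 * (1 - y))"
  proof (rule mult_mono)
    show "A \<le> 2 * (1 - x)"
      using mult_right_mono[of x 1 "1 - x"] x by (simp add: A_def power2_eq_square algebra_simps)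
    have "(norm z)\<^sup>2 \<le> (1/2)\<^sup>2"
      using z by (intro power_mono) auto
    then have d: "1/2 \<le> 1 - (norm z)\<^sup>2"
      by (simp add: power2_eq_square)
    have n: "1 - y\<^sup>2 \<le> 2 * (1 - y)" "0 \<le> 1 - y\<^sup>2"
      using mult_right_mono[of y 1 "1 - y"] y by (auto simp: power2_eq_square algebra_simps mult_le_one)
    have "C \<le> (2 * (1 - y)) / (1/2)"
      unfolding C_def by (intro frac_le n d) (use y in auto)
    then show "C \<le> 4 * (1 - y)" by simp
    show "0 \<le> C"
      unfolding C_def using n d by (intro divide_nonneg_nonneg) auto
  qed (use x in auto)
  finally have "(1 - x) * (1 - x) \<le> (1 - x) * (8 * (1 - y))"
    by (simp add: power2_eq_square algebra_simps)
  then show ?thesis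
    using x by (simp add: x_def y_def)
qed

section \<open>Complex lines in several variables\<close>

lemma norm_vector_smult: "norm (c *s (v :: complex ^ 'n)) = norm c * norm v"
  by (simp add: norm_vec_def L2_set_def norm_mult power_mult_distrib sum_distrib_left[symmetric]
      real_sqrt_mult)

lemma line_has_derivative:
  "((\<lambda>\<zeta>. a + \<zeta> *s (v :: complex ^ 'n)) has_derivative (\<lambda>\<zeta>. \<zeta> *s v)) (at \<zeta> within S)"
proof -
  have "linear (\<lambda>\<zeta>. \<zeta> *s v)"
    by (rule linearI) (simp_all add: vec_eq_iff algebra_simps)
  then have "bounded_linear (\<lambda>\<zeta>. \<zeta> *s v)"
    by (simp add: linear_conv_bounded_linear)
  then have "((\<lambda>\<zeta>. \<zeta> *s v) has_derivative (\<lambda>\<zeta>. \<zeta> *s v)) (at \<zeta> within S)"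
    by (rule bounded_linear_imp_has_derivative)
  from has_derivative_add[OF has_derivative_const this, of a] show ?thesis
    by simp
qed

lemma holomorphic_on_line:
  assumes "holomorphic_Cm f \<Omega>" "\<And>\<zeta>. \<zeta> \<in> S \<Longrightarrow> a + \<zeta> *s v \<in> \<Omega>"
  shows "(\<lambda>\<zeta>. f (a + \<zeta> *s v)) holomorphic_on S"
  unfolding holomorphic_on_def
proof
  fix \<zeta> assume "\<zeta> \<in> S"
  then obtain D where D: "(f has_derivative D) (at (a + \<zeta> *s v) within \<Omega>)" "\<And>c v. D (c *s v) = c * D v"
    using assms unfolding holomorphic_Cm_def by blast
  have "((\<lambda>\<zeta>. f (a + \<zeta> *s v)) has_derivative (\<lambda>\<zeta>. D (\<zeta> *s v))) (at \<zeta> within S)"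
    by (rule has_derivative_in_compose[OF line_has_derivative])
      (use assms(2) in \<open>auto intro: has_derivative_subset[OF D(1)]\<close>)
  then have "((\<lambda>\<zeta>. f (a + \<zeta> *s v)) has_field_derivative D v) (at \<zeta> within S)"
    by (simp add: has_field_derivative_def D(2) mult.commute[of _ "D v"])
  then show "(\<lambda>\<zeta>. f (a + \<zeta> *s v)) field_differentiable at \<zeta> within S"
    unfolding field_differentiable_def by blast
qed

lemma holomorphic_Cm_compose:
  assumes "holomorphic_Cm f \<Omega>" "m holomorphic_on U" "open U" "f ` \<Omega> \<subseteq> U"
  shows "holomorphic_Cm (\<lambda>z. m (f z)) \<Omega>"
  unfolding holomorphic_Cm_def
proof
  fix z assume z: "z \<in> \<Omega>"
  then obtain D where D: "(f has_derivative D) (at z within \<Omega>)" "\<And>c v. D (c *s v) = c * D v"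
    using assms(1) unfolding holomorphic_Cm_def by blast
  have "(m has_field_derivative deriv m (f z)) (at (f z))"
    using assms z by (intro holomorphic_derivI[OF assms(2,3)]) auto
  then have "((\<lambda>z. m (f z)) has_derivative (\<lambda>h. deriv m (f z) * D h)) (at z within \<Omega>)"
    unfolding has_field_derivative_def by (rule has_derivative_compose[OF D(1)])
  then show "\<exists>D. ((\<lambda>z. m (f z)) has_derivative D) (at z within \<Omega>) \<and> (\<forall>c v. D (c *s v) = c * D v)"
    using D(2) by (auto simp: algebra_simps)
qed

lemma schur_class_iff:
  assumes "\<Omega> \<noteq> {}"
  shows "f \<in> schur_class \<Omega> \<longleftrightarrow> holomorphic_Cm f \<Omega> \<and> (\<forall>z\<in>\<Omega>. norm (f z) \<le> 1)"
proof
  assume f: "f \<in> schur_class \<Omega>"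
  then have "bdd_above ((\<lambda>z. norm (f z)) ` \<Omega>)"
    by (auto simp: schur_class_def H_infinity_def bounded_iff bdd_above_def)
  then have "norm (f z) \<le> 1" if "z \<in> \<Omega>" for z
    using cSUP_upper[OF that, of "\<lambda>z. norm (f z)"] f by (auto simp: schur_class_def)
  then show "holomorphic_Cm f \<Omega> \<and> (\<forall>z\<in>\<Omega>. norm (f z) \<le> 1)"
    using f by (auto simp: schur_class_def H_infinity_def)
next
  assume "holomorphic_Cm f \<Omega> \<and> (\<forall>z\<in>\<Omega>. norm (f z) \<le> 1)"
  then show "f \<in> schur_class \<Omega>"
    using assms by (auto simp: schur_class_def H_infinity_def bounded_iff intro!: cSUP_least)
qed

lemma schur_class_pick_on_line:
  assumes "f \<in> schur_class \<Omega>" "\<And>\<zeta>. norm \<zeta> \<le> 1 \<Longrightarrow> a + \<zeta> *s v \<in> \<Omega>"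
  shows "psd_on (ball 0 1) (pick_kernel (\<lambda>\<zeta>. f (a + \<zeta> *s v)))"
proof (rule psd_on_pick_kernel)
  have "\<Omega> \<noteq> {}" using assms(2)[of 0] by auto
  with assms(1) have f: "holomorphic_Cm f \<Omega>" "\<And>z. z \<in> \<Omega> \<Longrightarrow> norm (f z) \<le> 1"
    by (auto simp: schur_class_iff)
  show "(\<lambda>\<zeta>. f (a + \<zeta> *s v)) holomorphic_on cball 0 1"
    using f(1) assms(2) by (intro holomorphic_on_line) auto
  show "norm (f (a + \<zeta> *s v)) \<le> 1" if "norm \<zeta> \<le> 1" for \<zeta>
    using that by (intro f(2) assms(2))
qed

section \<open>Schur functions vanishing at a point are test functions\<close>

definition based_schur_class :: "(complex ^ 'm) set \<Rightarrow> complex ^ 'm \<Rightarrow> (complex ^ 'm \<Rightarrow> complex) set" where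
  "based_schur_class \<Omega> w = {\<psi> \<in> schur_class \<Omega>. \<psi> w = 0}"

lemma schur_class_distance_to_circle:
  assumes f: "f \<in> schur_class \<Omega>" and r: "cball x r \<subseteq> \<Omega>" "2 * norm (y - x) \<le> r"
  shows "1 - norm (f x) \<le> 8 * (1 - norm (f y))"
proof -
  define g where "g \<zeta> = f (x + \<zeta> *s (2 *s (y - x)))" for \<zeta>
  have in_\<Omega>: "x + \<zeta> *s (2 *s (y - x)) \<in> \<Omega>" if "norm \<zeta> \<le> 1" for \<zeta>
  proof -
    have "norm (\<zeta> *s (2 *s (y - x))) \<le> 1 * r"
      unfolding norm_vector_smult using that r(2) by (intro mult_mono) auto
    moreover have "dist x (x + h) = norm h" for h
      by (simp add: dist_norm)
    ultimately show ?thesis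
      using r(1) by (intro subsetD[OF r(1)]) simp
  qed
  have "\<Omega> \<noteq> {}" using in_\<Omega>[of 0] by auto
  with f have f': "holomorphic_Cm f \<Omega>" "\<And>z. z \<in> \<Omega> \<Longrightarrow> norm (f z) \<le> 1"
    by (auto simp: schur_class_iff)
  have "g holomorphic_on cball 0 1"
    unfolding g_def using in_\<Omega> by (intro holomorphic_on_line[OF f'(1)]) auto
  then have "1 - norm (g 0) \<le> 8 * (1 - norm (g (1/2)))"
  proof (rule holomorphic_schwarz_pick_distance_to_circle)
    show "norm (g \<zeta>) \<le> 1" if "norm \<zeta> \<le> 1" for \<zeta>
      unfolding g_def using that by (intro f'(2) in_\<Omega>)
  qed simp
  moreover have "g 0 = f x" "g (1/2) = f y"
    by (simp_all add: g_def vector_smult_assoc)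
  ultimately show ?thesis by simp
qed

text \<open>
  By the previous estimate, the set of points at which the class is bounded away from the unit circle
  is open and closed in the domain; it contains the base point.
\<close>
lemma based_schur_class_uniform_bound:
  assumes "open \<Omega>" "connected \<Omega>" "w \<in> \<Omega>" "z \<in> \<Omega>"
  shows "\<exists>c<1. \<forall>\<psi>\<in>based_schur_class \<Omega> w. norm (\<psi> z) \<le> c"
proof (rule connected_induction_simple[OF assms(2-4)])
  show "\<exists>c<1. \<forall>\<psi>\<in>based_schur_class \<Omega> w. norm (\<psi> w) \<le> c"
    by (intro exI[of _ 0]) (simp add: based_schur_class_def)
next
  fix a assume "a \<in> \<Omega>"
  then obtain r where r: "r > 0" "cball a r \<subseteq> \<Omega>"
    using assms(1) open_contains_cball_eq by blast
  \<comment> \<open>Two points of this ball are so close that the disc from one through the other, doubled, stays in the domain.\<close>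
  define T where "T = ball a (r/5)"
  have "openin (top_of_set \<Omega>) T"
    using r by (auto simp: openin_open_eq[OF assms(1)] T_def subset_iff)
  moreover have "\<exists>c<1. \<forall>\<psi>\<in>based_schur_class \<Omega> w. norm (\<psi> y) \<le> c"
    if xy: "x \<in> T" "y \<in> T" and c: "c < 1" "\<forall>\<psi>\<in>based_schur_class \<Omega> w. norm (\<psi> x) \<le> c" for x y c
  proof -
    have d: "norm (y - x) \<le> 2 * r / 5"
      using xy dist_triangle_less_add[of y a "r/5" x "r/5"] by (simp add: T_def dist_norm norm_minus_commute)
    have sub: "cball x (4 * r / 5) \<subseteq> \<Omega>"
    proof
      fix u assume "u \<in> cball x (4 * r / 5)"
      then have "u \<in> cball a r"
        using xy(1) dist_triangle[of a u x] by (simp add: T_def)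
      then show "u \<in> \<Omega>" using r(2) by blast
    qed
    have "norm (\<psi> y) \<le> 1 - (1 - c) / 8" if \<psi>: "\<psi> \<in> based_schur_class \<Omega> w" for \<psi>
    proof -
      have "1 - norm (\<psi> x) \<le> 8 * (1 - norm (\<psi> y))"
        using \<psi> sub d by (intro schur_class_distance_to_circle[where r = "4 * r / 5"]) (auto simp: based_schur_class_def)
      moreover have "norm (\<psi> x) \<le> c"
        using c(2) \<psi> by blast
      ultimately show ?thesis by (simp add: field_simps)
    qed
    then show ?thesis
      using c(1) by (intro exI[of _ "1 - (1 - c) / 8"]) auto
  qed
  ultimately show "\<exists>T. openin (top_of_set \<Omega>) T \<and> a \<in> T \<and> (\<forall>x\<in>T. \<forall>y\<in>T.
      (\<exists>c<1. \<forall>\<psi>\<in>based_schur_class \<Omega> w. norm (\<psi> x) \<le> c) \<longrightarrow>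
      (\<exists>c<1. \<forall>\<psi>\<in>based_schur_class \<Omega> w. norm (\<psi> y) \<le> c))"
    using r(1) by (intro exI[of _ T]) (auto simp: T_def)
qed

lemma based_schur_class_separates:
  assumes "caratheodory_hyperbolic \<Omega>" "w \<in> \<Omega>" "p \<in> \<Omega>" "q \<in> \<Omega>" "p \<noteq> q"
  shows "\<exists>\<psi>\<in>based_schur_class \<Omega> w. \<psi> p \<noteq> \<psi> q"
proof -
  obtain f where f: "holomorphic_Cm f \<Omega>" "bounded (f ` \<Omega>)" "f p \<noteq> f q"
    using assms unfolding caratheodory_hyperbolic_def H_infinity_def by blast
  obtain M where M: "M > 0" "\<And>z. z \<in> \<Omega> \<Longrightarrow> norm (f z) \<le> M"
    using f(2) unfolding bounded_pos by auto
  define \<psi> where "\<psi> z = (f z - f w) / of_real (2 * M)" for z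
  have "holomorphic_Cm \<psi> \<Omega>"
    unfolding \<psi>_def using M(1)
    by (intro holomorphic_Cm_compose[OF f(1), where U = UNIV] holomorphic_intros) auto
  moreover have "norm (\<psi> z) \<le> 1" if "z \<in> \<Omega>" for z
  proof -
    have "norm (f z - f w) \<le> 2 * M"
      using norm_triangle_ineq4[of "f z" "f w"] M(2)[OF that] M(2)[OF assms(2)] by linarith
    then show ?thesis
      using M(1) by (simp add: \<psi>_def norm_divide norm_mult)
  qed
  ultimately have "\<psi> \<in> based_schur_class \<Omega> w"
    using assms(2) schur_class_iff[of \<Omega> \<psi>] by (auto simp: based_schur_class_def \<psi>_def[of w])
  moreover have "\<psi> p \<noteq> \<psi> q"
    using f(3) M(1) by (simp add: \<psi>_def)
  ultimately show ?thesis by blast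
qed

lemma generated_algebra_restrict:
  shows restrict_const_generated_algebra: "restrict (\<lambda>z. c) F \<in> generated_algebra F (insert (\<lambda>z. 1) G)"
    and restrict_add_generated_algebra: "\<lbrakk>restrict f F \<in> generated_algebra F H; restrict g F \<in> generated_algebra F H\<rbrakk>
      \<Longrightarrow> restrict (\<lambda>z. f z + g z) F \<in> generated_algebra F H"
    and restrict_mult_generated_algebra: "\<lbrakk>restrict f F \<in> generated_algebra F H; restrict g F \<in> generated_algebra F H\<rbrakk>
      \<Longrightarrow> restrict (\<lambda>z. f z * g z) F \<in> generated_algebra F H"
proof -
  have "restrict (\<lambda>z. c * restrict (\<lambda>z. 1) F z) F = restrict (\<lambda>z. c) F"
    by (rule restrict_ext) simp
  then show "restrict (\<lambda>z. c) F \<in> generated_algebra F (insert (\<lambda>z. 1) G)"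
    by (metis generated_algebra.generator generated_algebra.scale insertI1)
next
  assume "restrict f F \<in> generated_algebra F H" "restrict g F \<in> generated_algebra F H"
  moreover have "restrict (\<lambda>z. restrict f F z + restrict g F z) F = restrict (\<lambda>z. f z + g z) F"
    by (rule restrict_ext) simp
  moreover have "restrict (\<lambda>z. restrict f F z * restrict g F z) F = restrict (\<lambda>z. f z * g z) F"
    by (rule restrict_ext) simp
  ultimately show "restrict (\<lambda>z. f z + g z) F \<in> generated_algebra F H"
      "restrict (\<lambda>z. f z * g z) F \<in> generated_algebra F H"
    by (metis generated_algebra.add, metis generated_algebra.mult)
qed

text \<open>
  Products of normalised differences \<open>(\<psi> z - \<psi> q) / (\<psi> p - \<psi> q)\<close> give the indicator functions of the
  points of the finite set.
\<close>
lemma generated_algebra_separating: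
  fixes F :: "'a set"
  assumes "finite F" and sep: "\<And>p q. p \<in> F \<Longrightarrow> q \<in> F \<Longrightarrow> p \<noteq> q \<Longrightarrow> \<exists>\<psi>\<in>\<Psi>. \<psi> p \<noteq> \<psi> q"
  shows "generated_algebra F (insert (\<lambda>z. 1) \<Psi>) = F \<rightarrow>\<^sub>E (UNIV :: complex set)"
proof
  show "generated_algebra F (insert (\<lambda>z. 1) \<Psi>) \<subseteq> F \<rightarrow>\<^sub>E UNIV"
  proof
    fix h assume "h \<in> generated_algebra F (insert (\<lambda>z. 1) \<Psi>)"
    then show "h \<in> F \<rightarrow>\<^sub>E UNIV"
      by induction auto
  qed
next
  let ?A = "generated_algebra F (insert (\<lambda>z. 1) \<Psi>)"
  obtain s where s: "\<And>p q. p \<in> F \<Longrightarrow> q \<in> F \<Longrightarrow> p \<noteq> q \<Longrightarrow> s p q \<in> \<Psi> \<and> s p q p \<noteq> s p q q"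
    using sep by metis
  define L where "L p z = (\<Prod>q\<in>F - {p}. (s p q z + - s p q q) * inverse (s p q p - s p q q))" for p z
  have prod: "restrict (\<lambda>z. \<Prod>q\<in>Q. u q z) F \<in> ?A"
    if "finite Q" "\<And>q. q \<in> Q \<Longrightarrow> restrict (u q) F \<in> ?A" for u :: "'a \<Rightarrow> 'a \<Rightarrow> complex" and Q
    using that
    by (induction Q rule: finite_induct)
      (auto intro: restrict_const_generated_algebra restrict_mult_generated_algebra)
  have sum: "restrict (\<lambda>z. \<Sum>q\<in>Q. u q z) F \<in> ?A"
    if "finite Q" "\<And>q. q \<in> Q \<Longrightarrow> restrict (u q) F \<in> ?A" for u :: "'a \<Rightarrow> 'a \<Rightarrow> complex" and Q
    using that
    by (induction Q rule: finite_induct)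
      (auto intro: restrict_const_generated_algebra restrict_add_generated_algebra)
  have L: "restrict (L p) F \<in> ?A" if "p \<in> F" for p
    unfolding L_def using assms(1) that s
    by (intro prod restrict_mult_generated_algebra restrict_add_generated_algebra
        restrict_const_generated_algebra generated_algebra.generator) auto
  have L_eq: "L p z = (if z = p then 1 else 0)" if "p \<in> F" "z \<in> F" for p z
  proof (cases "z = p")
    case True
    have "(s p q p + - s p q q) * inverse (s p q p - s p q q) = 1" if "q \<in> F - {p}" for q
      using s[of p q] that \<open>p \<in> F\<close> by (auto simp: right_inverse)
    then show ?thesis
      by (simp add: L_def True prod.neutral)
  next
    case False
    then show ?thesis
      using that assms(1) by (auto simp: L_def)
  qed
  show "F \<rightarrow>\<^sub>E UNIV \<subseteq> ?A"
  proof
    fix h :: "'a \<Rightarrow> complex" assume h: "h \<in> F \<rightarrow>\<^sub>E UNIV"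
    have "restrict (\<lambda>z. \<Sum>p\<in>F. h p * L p z) F \<in> ?A"
      using assms(1) L by (intro sum restrict_mult_generated_algebra restrict_const_generated_algebra) auto
    also have "restrict (\<lambda>z. \<Sum>p\<in>F. h p * L p z) F = restrict h F"
    proof (rule restrict_ext)
      fix z assume "z \<in> F"
      then have "(\<Sum>p\<in>F. h p * L p z) = (\<Sum>p\<in>F. if p = z then h p else 0)"
        by (intro sum.cong) (auto simp: L_eq)
      then show "(\<Sum>p\<in>F. h p * L p z) = h z"
        using \<open>z \<in> F\<close> assms(1) by simp
    qed
    also have "restrict h F = h"
      using h by (simp add: PiE_iff extensional_restrict)
    finally show "h \<in> ?A" .
  qed
qed

lemma test_functions_based_schur_class:
  assumes "open \<Omega>" "connected \<Omega>" "caratheodory_hyperbolic \<Omega>" "w \<in> \<Omega>"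
  shows "test_functions \<Omega> (based_schur_class \<Omega> w)"
  unfolding test_functions_def
proof (intro conjI ballI allI impI)
  fix z assume "z \<in> \<Omega>"
  then obtain c where c: "c < 1" "\<And>\<psi>. \<psi> \<in> based_schur_class \<Omega> w \<Longrightarrow> norm (\<psi> z) \<le> c"
    using based_schur_class_uniform_bound[OF assms(1,2,4)] by blast
  then have "(SUP \<psi>\<in>based_schur_class \<Omega> w. ereal (norm (\<psi> z))) \<le> ereal c"
    by (intro SUP_least) simp
  also have "\<dots> < 1" using c(1) by simp
  finally show "(SUP \<psi>\<in>based_schur_class \<Omega> w. ereal (norm (\<psi> z))) < 1" .
next
  fix F assume "finite F \<and> F \<subseteq> \<Omega>"
  then show "generated_algebra F (insert (\<lambda>z. 1) (based_schur_class \<Omega> w)) = F \<rightarrow>\<^sub>E UNIV"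
    using based_schur_class_separates[OF assms(3,4)] by (intro generated_algebra_separating) (auto simp: subset_iff)
qed

section \<open>Schur functions belong to the Schur-Agler class\<close>

text \<open>
  With \<open>a = f w\<close>, the composition \<open>\<phi> = (f - a) / (1 - cnj a * f)\<close> vanishes at \<open>w\<close>, and
  \<open>1 - \<phi> z * cnj (\<phi> z')\<close> differs from \<open>1 - f z * cnj (f z')\<close> by a congruence.
\<close>
lemma strict_schur_function_contractive:
  assumes k: "k \<in> admissible_kernels \<Omega> (based_schur_class \<Omega> w)"
    and w: "w \<in> \<Omega>" and hol: "holomorphic_Cm f \<Omega>" and bound: "\<And>z. z \<in> \<Omega> \<Longrightarrow> norm (f z) < 1"
  shows "psd_on \<Omega> (\<lambda>z z'. (1 - f z * cnj (f z')) * k z z')"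
proof -
  define a where "a = f w"
  have a: "norm a < 1" using bound[OF w] by (simp add: a_def)
  define \<phi> where "\<phi> z = Moebius_function 0 a (f z)" for z
  have "holomorphic_Cm \<phi> \<Omega>"
    unfolding \<phi>_def using bound
    by (intro holomorphic_Cm_compose[OF hol Moebius_function_holomorphic[OF a]]) auto
  moreover have "norm (\<phi> z) < 1" if "z \<in> \<Omega>" for z
    unfolding \<phi>_def by (intro Moebius_function_norm_lt_1 a bound that)
  ultimately have "\<phi> \<in> based_schur_class \<Omega> w"
    using w schur_class_iff[of \<Omega> \<phi>]
    by (force simp: based_schur_class_def \<phi>_def[of w] a_def Moebius_function_eq_zero)
  then have psd: "psd_on \<Omega> (\<lambda>z z'. (1 - \<phi> z * cnj (\<phi> z')) * k z z')"
    using k by (auto simp: admissible_kernels_def)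
  define d where "d = complex_of_real (1 / sqrt (1 - (norm a)\<^sup>2))"
  have d: "d * cnj d * (1 - a * cnj a) = 1"
  proof -
    have "(norm a)\<^sup>2 < 1" using a by (simp add: power_less_one_iff abs_square_less_1)
    then have "1 / sqrt (1 - (norm a)\<^sup>2) * (1 / sqrt (1 - (norm a)\<^sup>2)) * (1 - (norm a)\<^sup>2) = 1"
      by simp
    moreover have "d * cnj d * (1 - a * cnj a) =
        of_real (1 / sqrt (1 - (norm a)\<^sup>2) * (1 / sqrt (1 - (norm a)\<^sup>2)) * (1 - (norm a)\<^sup>2))"
      unfolding of_real_mult of_real_diff complex_norm_square of_real_1 d_def complex_cnj_complex_of_real
      by (rule refl)
    ultimately show ?thesis by simp
  qed
  define m where "m z = d * (1 - cnj a * f z)" for z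
  have "psd_on \<Omega> (\<lambda>z z'. m z * ((1 - \<phi> z * cnj (\<phi> z')) * k z z') * cnj (m z'))"
    using psd_on_pullback_congruence[OF psd, of "\<lambda>z. z"] by simp
  also have "?this \<longleftrightarrow> ?thesis"
  proof (rule psd_on_cong)
    fix z z' assume z: "z \<in> \<Omega>" "z' \<in> \<Omega>"
    have nz: "1 - cnj a * f y \<noteq> 0" if "y \<in> \<Omega>" for y
      using one_minus_mult_cnj_nonzero[of "f y" a] bound[OF that] a by (simp add: mult.commute)
    have \<phi>: "\<phi> y * (1 - cnj a * f y) = f y - a" if "y \<in> \<Omega>" for y
      using nz[OF that] by (simp add: \<phi>_def Moebius_function_simple)
    have \<phi>': "cnj (\<phi> z') * (1 - a * cnj (f z')) = cnj (f z') - cnj a"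
      using \<phi>[OF z(2)] by (metis complex_cnj_cnj complex_cnj_diff complex_cnj_mult complex_cnj_one)
    have "(1 - cnj a * f z) * (1 - \<phi> z * cnj (\<phi> z')) * (1 - a * cnj (f z'))
        = (1 - cnj a * f z) * (1 - a * cnj (f z')) - (f z - a) * (cnj (f z') - cnj a)"
      unfolding \<phi>[OF z(1), symmetric] \<phi>'[symmetric] by (simp add: algebra_simps)
    also have "\<dots> = (1 - a * cnj a) * (1 - f z * cnj (f z'))"
      by (simp add: algebra_simps)
    finally have "m z * ((1 - \<phi> z * cnj (\<phi> z')) * k z z') * cnj (m z')
        = (d * cnj d * (1 - a * cnj a)) * ((1 - f z * cnj (f z')) * k z z')"
      by (simp add: m_def mult.assoc mult.left_commute mult.commute)
    then show "m z * ((1 - \<phi> z * cnj (\<phi> z')) * k z z') * cnj (m z') = (1 - f z * cnj (f z')) * k z z'"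
      by (simp only: d mult_1_left)
  qed
  finally show ?thesis .
qed

text \<open>
  For \<open>r < 1\<close> the function \<open>r f\<close> is bounded by \<open>r\<close>, so that the previous lemma applies; positivity
  survives the limit \<open>r \<longlongrightarrow> 1\<close>.
\<close>
lemma schur_class_subset_schur_agler_class:
  assumes w: "w \<in> \<Omega>"
  shows "schur_class \<Omega> \<subseteq> schur_agler_class \<Omega> (based_schur_class \<Omega> w)"
  unfolding schur_agler_class_def
proof (intro subsetI CollectI ballI psd_onI)
  fix f k zs and c :: "nat \<Rightarrow> complex"
  assume f: "f \<in> schur_class \<Omega>" and k: "k \<in> admissible_kernels \<Omega> (based_schur_class \<Omega> w)"
    and zs: "set zs \<subseteq> \<Omega>"
  have f': "holomorphic_Cm f \<Omega>" "\<And>z. z \<in> \<Omega> \<Longrightarrow> norm (f z) \<le> 1"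
    using f w schur_class_iff[of \<Omega> f] by auto
  define S where "S r = (\<Sum>i<length zs. \<Sum>j<length zs.
      cnj (c i) * ((1 - (of_real r * f (zs!i)) * cnj (of_real r * f (zs!j))) * k (zs!i) (zs!j)) * c j)" for r
  have S: "S r \<in> \<real>\<^sub>\<ge>\<^sub>0" if r: "r \<in> {0<..<1}" for r
  proof -
    have "psd_on \<Omega> (\<lambda>z z'. (1 - (of_real r * f z) * cnj (of_real r * f z')) * k z z')"
    proof (rule strict_schur_function_contractive[OF k w])
      show "holomorphic_Cm (\<lambda>z. of_real r * f z) \<Omega>"
        by (intro holomorphic_Cm_compose[OF f'(1), where U = UNIV] holomorphic_intros) auto
      show "norm (of_real r * f z) < 1" if "z \<in> \<Omega>" for z
      proof -
        have "norm (of_real r * f z) = r * norm (f z)"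
          using r by (simp add: norm_mult)
        also have "\<dots> \<le> r * 1"
          using r by (intro mult_left_mono f'(2) that) auto
        also have "\<dots> < 1" using r by simp
        finally show ?thesis .
      qed
    qed
    then show ?thesis
      unfolding S_def by (rule psd_onD) (rule zs)
  qed
  have "(S \<longlongrightarrow> S 1) (at_left 1)"
    unfolding S_def by (intro tendsto_intros)
  then have "S 1 \<in> \<real>\<^sub>\<ge>\<^sub>0"
  proof (rule Lim_in_closed_set[rotated 3])
    show "\<forall>\<^sub>F r in at_left 1. S r \<in> \<real>\<^sub>\<ge>\<^sub>0"
      using eventually_at_left_real[of 0 1] by (rule eventually_mono) (use S in auto)
  qed auto
  then show "(\<Sum>i<length zs. \<Sum>j<length zs.
      cnj (c i) * ((1 - f (zs!i) * cnj (f (zs!j))) * k (zs!i) (zs!j)) * c j) \<in> \<real>\<^sub>\<ge>\<^sub>0"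
    by (simp add: S_def)
qed

section \<open>Schur-Agler functions are bounded and satisfy Pick's condition on discs\<close>

text \<open>
  The diagonal kernel is admissible because the test functions are bounded by 1.
\<close>
lemma schur_agler_class_bounded:
  assumes f: "f \<in> schur_agler_class \<Omega> \<Psi>" and \<Psi>: "\<And>\<psi> z. \<psi> \<in> \<Psi> \<Longrightarrow> z \<in> \<Omega> \<Longrightarrow> norm (\<psi> z) \<le> 1"
    and z: "z \<in> \<Omega>"
  shows "norm (f z) \<le> 1"
proof -
  define k where "k z w = (if z = w then complex_of_real 1 else 0)" for z w :: 'a
  have "k \<in> admissible_kernels \<Omega> \<Psi>"
    unfolding admissible_kernels_def
  proof (intro CollectI conjI ballI)
    show "psd_on \<Omega> k"
      unfolding k_def by (rule psd_on_diagonal) simp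
    fix \<psi> assume "\<psi> \<in> \<Psi>"
    have "psd_on \<Omega> (\<lambda>z w. if z = w then complex_of_real (1 - (norm (\<psi> z))\<^sup>2) else 0)"
      using \<Psi>[OF \<open>\<psi> \<in> \<Psi>\<close>] by (intro psd_on_diagonal) (simp add: power_le_one)
    also have "?this \<longleftrightarrow> psd_on \<Omega> (\<lambda>z w. (1 - \<psi> z * cnj (\<psi> w)) * k z w)"
      by (rule psd_on_cong) (simp add: k_def flip: complex_norm_square)
    finally show "psd_on \<Omega> (\<lambda>z w. (1 - \<psi> z * cnj (\<psi> w)) * k z w)" .
  qed
  then have "psd_on \<Omega> (\<lambda>z w. (1 - f z * cnj (f w)) * k z w)"
    using f by (simp add: schur_agler_class_def)
  from psd_onD[OF this, of "[z]" "\<lambda>_. 1"] z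
  have "complex_of_real (1 - (norm (f z))\<^sup>2) \<in> \<real>\<^sub>\<ge>\<^sub>0"
    by (simp add: k_def flip: complex_norm_square)
  then show ?thesis
    unfolding nonneg_Reals_of_real_iff by (simp add: abs_square_le_1)
qed

text \<open>
  The Szego kernel of the disc, carried to a complex line and extended by zero, is admissible: on the
  disc this is the positivity of the Pick kernels of the test functions, and points off the disc do
  not contribute. The jump at the boundary is harmless because admissibility is a condition on finite
  sets of points.
\<close>
lemma schur_agler_class_pick_on_line:
  assumes f: "f \<in> schur_agler_class \<Omega> \<Psi>" and \<Psi>: "\<Psi> \<subseteq> schur_class \<Omega>"
    and "v \<noteq> 0" and in_\<Omega>: "\<And>\<zeta>. norm \<zeta> \<le> 1 \<Longrightarrow> a + \<zeta> *s v \<in> \<Omega>"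
  shows "psd_on (ball 0 1) (pick_kernel (\<lambda>\<zeta>. f (a + \<zeta> *s v)))"
proof -
  let ?\<gamma> = "\<lambda>\<zeta>. a + \<zeta> *s v"
  have inj: "inj_on ?\<gamma> (ball 0 1)"
    using \<open>v \<noteq> 0\<close> by (auto simp: inj_on_def)
  define \<Delta> where "\<Delta> = ?\<gamma> ` ball 0 1"
  define p where "p z = (if z \<in> \<Delta> then inv_into (ball 0 1) ?\<gamma> z else 0)" for z
  define m where "m z = (if z \<in> \<Delta> then 1 else 0 :: complex)" for z
  have p: "p z \<in> ball 0 1" "z \<in> \<Delta> \<Longrightarrow> ?\<gamma> (p z) = z" for z
    unfolding p_def \<Delta>_def using inv_into_into[of z ?\<gamma> "ball 0 1"] f_inv_into_f[of z ?\<gamma> "ball 0 1"] by auto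
  have p_\<gamma>: "p (?\<gamma> \<zeta>) = \<zeta>" "m (?\<gamma> \<zeta>) = 1" if "\<zeta> \<in> ball 0 1" for \<zeta>
    using that inv_into_f_f[OF inj that] by (auto simp: p_def m_def \<Delta>_def)
  define k where "k z w = m z * szego (p z) (p w) * cnj (m w)" for z w
  have "k \<in> admissible_kernels \<Omega> \<Psi>"
    unfolding admissible_kernels_def
  proof (intro CollectI conjI ballI)
    show "psd_on \<Omega> k"
      unfolding k_def using p(1) by (intro psd_on_pullback_congruence[OF psd_on_szego]) auto
    fix \<psi> assume "\<psi> \<in> \<Psi>"
    then have "psd_on (ball 0 1) (pick_kernel (\<lambda>\<zeta>. \<psi> (?\<gamma> \<zeta>)))"
      using \<Psi> in_\<Omega> by (intro schur_class_pick_on_line) auto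
    then have "psd_on \<Omega> (\<lambda>z w. m z * pick_kernel (\<lambda>\<zeta>. \<psi> (?\<gamma> \<zeta>)) (p z) (p w) * cnj (m w))"
      using p(1) by (intro psd_on_pullback_congruence) auto
    also have "?this \<longleftrightarrow> psd_on \<Omega> (\<lambda>z w. (1 - \<psi> z * cnj (\<psi> w)) * k z w)"
      by (rule psd_on_cong) (simp add: k_def pick_kernel_def m_def p(2))
    finally show "psd_on \<Omega> (\<lambda>z w. (1 - \<psi> z * cnj (\<psi> w)) * k z w)" .
  qed
  then have "psd_on \<Omega> (\<lambda>z w. (1 - f z * cnj (f w)) * k z w)"
    using f by (simp add: schur_agler_class_def)
  then have "psd_on (ball 0 1) (\<lambda>\<zeta> \<eta>. 1 * ((1 - f (?\<gamma> \<zeta>) * cnj (f (?\<gamma> \<eta>))) * k (?\<gamma> \<zeta>) (?\<gamma> \<eta>)) * cnj 1)"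
    using in_\<Omega> by (intro psd_on_pullback_congruence) auto
  also have "?this \<longleftrightarrow> ?thesis"
    by (rule psd_on_cong) (simp add: k_def pick_kernel_def p_\<gamma>)
  finally show ?thesis .
qed

section \<open>Pick's condition on discs implies holomorphy\<close>

lemma has_field_derivative_of_quadratic_bound:
  fixes g :: "complex \<Rightarrow> complex"
  assumes "\<delta> > 0" and bound: "\<And>h. norm h \<le> \<delta> \<Longrightarrow> norm (g (x + h) - g x - h * D) \<le> C * (norm h)\<^sup>2"
  shows "(g has_field_derivative D) (at x)"
proof -
  have "((\<lambda>h. (g (x + h) - g x) / h - D) \<longlongrightarrow> 0) (at 0)"
  proof (rule Lim_null_comparison)
    have "\<forall>\<^sub>F h in at (0::complex). norm h < \<delta> \<and> h \<noteq> 0"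
      using \<open>\<delta> > 0\<close> by (auto simp: eventually_at intro!: exI[of _ \<delta>])
    then show "\<forall>\<^sub>F h in at 0. norm ((g (x + h) - g x) / h - D) \<le> C * norm h"
    proof (rule eventually_mono)
      fix h :: complex assume h: "norm h < \<delta> \<and> h \<noteq> 0"
      have "h * ((g (x + h) - g x) / h - D) = g (x + h) - g x - h * D"
        using h by (simp add: right_diff_distrib[of h "_ / _"] nonzero_mult_div_cancel_left)
      then have "norm h * norm ((g (x + h) - g x) / h - D) = norm (g (x + h) - g x - h * D)"
        by (simp only: norm_mult[symmetric])
      also have "\<dots> \<le> norm h * (C * norm h)"
        using bound[of h] h by (simp add: power2_eq_square mult.left_commute)
      finally show "norm ((g (x + h) - g x) / h - D) \<le> C * norm h"
        using h by simp
    qed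
    show "((\<lambda>h::complex. C * norm h) \<longlongrightarrow> 0) (at 0)"
      by (intro tendsto_eq_intros) auto
  qed
  then show ?thesis
    unfolding DERIV_def by (subst (asm) LIM_zero_iff)
qed

text \<open>
  A bounded function that satisfies Pick's condition on all small affine discs is holomorphic on
  complex lines, with a second-order Taylor estimate that is uniform over the lines. This makes the
  directional derivative a Frechet derivative as soon as it is additive in the direction. For that,
  the second difference \<open>f (a + s x + s y) - f (a + s x) - f (a + s y) + f a\<close> must be \<open>o(s)\<close>; it is
  the increment along \<open>x\<close> of the increment of \<open>f\<close> along \<open>s y\<close>, and both increments are Lipschitz.
\<close>
locale pick_on_lines =
  fixes \<Omega> :: "(complex ^ 'm) set" and f :: "complex ^ 'm \<Rightarrow> complex"
  assumes open_domain: "open \<Omega>"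
    and pick: "\<And>a v. v \<noteq> 0 \<Longrightarrow> (\<And>\<zeta>. norm \<zeta> \<le> 1 \<Longrightarrow> a + \<zeta> *s v \<in> \<Omega>) \<Longrightarrow>
      psd_on (ball 0 1) (pick_kernel (\<lambda>\<zeta>. f (a + \<zeta> *s v)))"
begin

lemma line_in_domain:
  assumes "cball b \<rho> \<subseteq> \<Omega>" "norm v \<le> \<rho>" "norm \<zeta> \<le> 1"
  shows "b + \<zeta> *s v \<in> \<Omega>"
proof -
  have "norm (\<zeta> *s v) \<le> 1 * \<rho>"
    unfolding norm_vector_smult using assms by (intro mult_mono) auto
  moreover have "dist b (b + h) = norm h" for h
    by (simp add: dist_norm)
  ultimately show ?thesis
    by (intro subsetD[OF assms(1)]) simp
qed

lemma lipschitz_on_line: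
  assumes "cball b \<rho> \<subseteq> \<Omega>" "norm v \<le> \<rho>" "norm s \<le> 1/2"
  shows "norm (f (b + s *s v) - f b) \<le> 2 * norm s"
proof (cases "v = 0")
  case False
  then have "psd_on (ball 0 1) (pick_kernel (\<lambda>\<zeta>. f (b + \<zeta> *s v)))"
    by (intro pick line_in_domain[OF assms(1,2)])
  from pick_two_point_bound[OF this assms(3)] show ?thesis by simp
qed auto

lemma taylor_on_line:
  assumes "cball b \<rho> \<subseteq> \<Omega>" "norm v \<le> \<rho>"
  obtains D where "((\<lambda>\<zeta>. f (b + \<zeta> *s v)) has_field_derivative D) (at 0)"
    and "\<And>s. norm s \<le> 1/2 \<Longrightarrow> norm (f (b + s *s v) - f b - s * D) \<le> 2 * (norm s)\<^sup>2"
proof (cases "v = 0")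
  case True
  show thesis by (rule that[of 0]) (simp_all add: True)
next
  case False
  then have "psd_on (ball 0 1) (pick_kernel (\<lambda>\<zeta>. f (b + \<zeta> *s v)))"
    by (intro pick line_in_domain[OF assms])
  from pick_imp_differentiable_at_0[OF this]
  obtain D where D: "\<And>s. norm s \<le> 1/2 \<Longrightarrow> norm (f (b + s *s v) - f (b + 0 *s v) - s * D) \<le> 2 * (norm s)\<^sup>2"
    by blast
  have "((\<lambda>\<zeta>. f (b + \<zeta> *s v)) has_field_derivative D) (at 0)"
    by (rule has_field_derivative_of_quadratic_bound[of "1/2" _ _ _ 2]) (use D in auto)
  then show thesis
    using that D by simp
qed

text \<open>
  Every point of the line is the centre of a small disc in the domain, so the estimate at the centre,
  rescaled by \<open>\<kappa>\<close>, applies.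
\<close>
lemma field_differentiable_on_line:
  assumes "a + \<zeta> *s v \<in> \<Omega>"
  shows "(\<lambda>\<eta>. f (a + \<eta> *s v)) field_differentiable at \<zeta>"
proof (cases "v = 0")
  case False
  define b where "b = a + \<zeta> *s v"
  obtain \<rho> where \<rho>: "\<rho> > 0" "cball b \<rho> \<subseteq> \<Omega>"
    using open_contains_cball_eq[OF open_domain] assms unfolding b_def by blast
  define \<kappa> where "\<kappa> = complex_of_real (\<rho> / norm v)"
  have "\<kappa> \<noteq> 0" using \<rho> False by (simp add: \<kappa>_def)
  have "norm (\<kappa> *s v) \<le> \<rho>"
    using \<rho> False by (simp add: norm_vector_smult \<kappa>_def norm_divide)
  from taylor_on_line[OF \<rho>(2) this]
  obtain D where D: "((\<lambda>\<eta>. f (b + \<eta> *s (\<kappa> *s v))) has_field_derivative D) (at 0)"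
    by blast
  have "((\<lambda>\<eta>. (\<eta> - \<zeta>) / \<kappa>) has_field_derivative 1 / \<kappa>) (at \<zeta>)"
    using \<open>\<kappa> \<noteq> 0\<close> by (auto intro!: derivative_eq_intros)
  from DERIV_chain2[of "\<lambda>\<eta>. f (b + \<eta> *s (\<kappa> *s v))", OF _ this] D
  have "((\<lambda>\<eta>. f (b + ((\<eta> - \<zeta>) / \<kappa>) *s (\<kappa> *s v))) has_field_derivative D * (1 / \<kappa>)) (at \<zeta>)"
    by simp
  also have "(\<lambda>\<eta>. f (b + ((\<eta> - \<zeta>) / \<kappa>) *s (\<kappa> *s v))) = (\<lambda>\<eta>. f (a + \<eta> *s v))"
    using \<open>\<kappa> \<noteq> 0\<close> by (simp add: b_def vector_smult_assoc vector_sub_rdistrib)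
  finally show ?thesis
    unfolding field_differentiable_def by blast
qed (simp add: field_differentiable_const)

definition directional_derivative :: "complex ^ 'm \<Rightarrow> complex ^ 'm \<Rightarrow> complex" where
  "directional_derivative a v = deriv (\<lambda>\<zeta>. f (a + \<zeta> *s v)) 0"

lemma directional_derivative:
  assumes "a \<in> \<Omega>"
  shows "((\<lambda>\<zeta>. f (a + \<zeta> *s v)) has_field_derivative directional_derivative a v) (at 0)"
  unfolding directional_derivative_def
  using field_differentiable_on_line[of a 0 v] assms by (simp add: field_differentiable_derivI)

lemma directional_derivative_smult:
  assumes "a \<in> \<Omega>"
  shows "directional_derivative a (c *s v) = c * directional_derivative a v"
proof -
  have "((\<lambda>\<zeta>. \<zeta> * c) has_field_derivative c) (at 0)"
    by (auto intro!: derivative_eq_intros)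
  from DERIV_chain2[of "\<lambda>\<zeta>. f (a + \<zeta> *s v)", OF _ this] directional_derivative[OF assms, of v]
  have "((\<lambda>\<zeta>. f (a + (\<zeta> * c) *s v)) has_field_derivative directional_derivative a v * c) (at 0)"
    by simp
  moreover have "((\<lambda>\<zeta>. f (a + (\<zeta> * c) *s v)) has_field_derivative directional_derivative a (c *s v)) (at 0)"
    using directional_derivative[OF assms, of "c *s v"] by (simp add: vector_smult_assoc)
  ultimately show ?thesis
    using DERIV_unique by (metis mult.commute)
qed

lemma directional_derivative_taylor:
  assumes "cball a \<rho> \<subseteq> \<Omega>" "norm v \<le> \<rho>" "norm s \<le> 1/2"
  shows "norm (f (a + s *s v) - f a - s * directional_derivative a v) \<le> 2 * (norm s)\<^sup>2"
proof -
  have "a \<in> \<Omega>"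
    using line_in_domain[OF assms(1,2), of 0] by simp
  from taylor_on_line[OF assms(1,2)] obtain D
    where D: "((\<lambda>\<zeta>. f (a + \<zeta> *s v)) has_field_derivative D) (at 0)"
      "norm (f (a + s *s v) - f a - s * D) \<le> 2 * (norm s)\<^sup>2"
    using assms(3) by blast
  have "D = directional_derivative a v"
    using DERIV_unique[OF D(1) directional_derivative[OF \<open>a \<in> \<Omega>\<close>]] .
  with D(2) show ?thesis by simp
qed

lemma second_difference_bound:
  assumes sub: "cball a (2 * \<rho>) \<subseteq> \<Omega>" and x: "norm x \<le> \<rho>" and y: "norm y \<le> \<rho>"
    and s: "norm s \<le> 1/2" "s \<noteq> 0"
  shows "norm (f (a + s *s x + s *s y) - f (a + s *s x) - f (a + s *s y) + f a) \<le> 4 * (norm s)\<^sup>2"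
proof -
  have \<rho>: "\<rho> \<ge> 0" using x norm_ge_zero order_trans by blast
  define \<phi> where "\<phi> \<zeta> = f (a + s *s y + \<zeta> *s x) - f (a + \<zeta> *s x)" for \<zeta>
  have shift: "cball (a + \<zeta> *s u) \<rho> \<subseteq> \<Omega>" if "norm \<zeta> \<le> 1" "norm u \<le> \<rho>" for \<zeta> u
  proof
    fix z assume z: "z \<in> cball (a + \<zeta> *s u) \<rho>"
    have "norm (\<zeta> *s u) \<le> 1 * \<rho>"
      unfolding norm_vector_smult using that by (intro mult_mono) auto
    then have "dist a (a + \<zeta> *s u) \<le> \<rho>"
      by (simp add: dist_norm)
    then have "z \<in> cball a (2 * \<rho>)"
      using z dist_triangle[of a z "a + \<zeta> *s u"] by simp
    then show "z \<in> \<Omega>" using sub by blast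
  qed
  have in_\<Omega>: "a + \<zeta> *s x \<in> \<Omega>" "a + s *s y + \<zeta> *s x \<in> \<Omega>" if "norm \<zeta> \<le> 1" for \<zeta>
  proof -
    show "a + \<zeta> *s x \<in> \<Omega>"
      using shift[OF that x] \<rho> by auto
    show "a + s *s y + \<zeta> *s x \<in> \<Omega>"
      by (rule line_in_domain[OF shift[OF _ y] x that]) (use s in simp)
  qed
  have "norm (\<phi> s - \<phi> 0) \<le> 2 * (2 * norm s) * norm s"
  proof (rule holomorphic_bounded_increment)
    show "\<phi> holomorphic_on cball 0 1"
      unfolding \<phi>_def holomorphic_on_def using in_\<Omega>
      by (auto intro!: field_differentiable_diff field_differentiable_at_within[OF field_differentiable_on_line])
    show "2 * norm s > 0" using s by simp
    show "norm (\<phi> \<zeta>) \<le> 2 * norm s" if "norm \<zeta> \<le> 1" for \<zeta>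
      using lipschitz_on_line[OF shift[OF that x] y s(1)] by (simp add: \<phi>_def algebra_simps)
  qed (fact s)
  then show ?thesis
    by (simp add: \<phi>_def algebra_simps power2_eq_square)
qed

lemma directional_derivative_add_small:
  assumes sub: "cball a (2 * \<rho>) \<subseteq> \<Omega>" and x: "norm x \<le> \<rho>" and y: "norm y \<le> \<rho>"
  shows "directional_derivative a (x + y) = directional_derivative a x + directional_derivative a y"
proof (rule ccontr)
  let ?D = "directional_derivative a"
  define E where "E = ?D (x + y) - ?D x - ?D y"
  assume "?D (x + y) \<noteq> ?D x + ?D y"
  then have "norm E > 0" by (simp add: E_def diff_diff_eq)
  have \<rho>: "\<rho> \<ge> 0" using x norm_ge_zero order_trans by blast
  \<comment> \<open>Three Taylor remainders and the second difference bound \<open>s E\<close> by a multiple of the square of \<open>s\<close>.\<close>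
  define r where "r = min (1/2) (norm E / 20)"
  define s where "s = complex_of_real r"
  have r: "r > 0" "r \<le> 1/2" "r \<le> norm E / 20"
    using \<open>norm E > 0\<close> by (auto simp: r_def)
  have s: "norm s = r" "norm s \<le> 1/2" "s \<noteq> 0"
    using r by (auto simp: s_def)
  define T where "T v = f (a + s *s v) - f a - s * ?D v" for v
  define N where "N = f (a + s *s x + s *s y) - f (a + s *s x) - f (a + s *s y) + f a"
  have T: "norm (T v) \<le> 2 * (norm s)\<^sup>2" if "norm v \<le> 2 * \<rho>" for v
    unfolding T_def by (rule directional_derivative_taylor[OF sub that s(2)])
  have N: "norm N \<le> 4 * (norm s)\<^sup>2"
    unfolding N_def by (rule second_difference_bound[OF sub x y s(2,3)])
  have "s * E = N - T (x + y) + T x + T y"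
    by (simp add: E_def N_def T_def algebra_simps vector_add_ldistrib)
  then have "norm (s * E) \<le> norm N + norm (T (x + y)) + norm (T x) + norm (T y)"
    using norm_triangle_ineq4[of N "T (x + y)"] norm_triangle_ineq[of "N - T (x + y)" "T x"]
      norm_triangle_ineq[of "N - T (x + y) + T x" "T y"] by simp
  also have "\<dots> \<le> 4 * (norm s)\<^sup>2 + 2 * (norm s)\<^sup>2 + 2 * (norm s)\<^sup>2 + 2 * (norm s)\<^sup>2"
    using x y \<rho> norm_triangle_ineq[of x y] by (intro add_mono N T) auto
  finally have "r * norm E \<le> r * (10 * r)"
    by (simp add: norm_mult s(1) power2_eq_square)
  then have "norm E \<le> 10 * r"
    using r(1) by simp
  with r(3) \<open>norm E > 0\<close> show False by simp
qed

lemma directional_derivative_add: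
  assumes "a \<in> \<Omega>"
  shows "directional_derivative a (x + y) = directional_derivative a x + directional_derivative a y"
proof -
  obtain \<epsilon> where \<epsilon>: "\<epsilon> > 0" "cball a \<epsilon> \<subseteq> \<Omega>"
    using open_contains_cball_eq[OF open_domain] assms by blast
  define n where "n = norm x + norm y + 1"
  define r where "r = (\<epsilon> / 2) / n"
  define c where "c = complex_of_real r"
  \<comment> \<open>By homogeneity both vectors may be shrunk until the previous lemma applies.\<close>
  have "n > 0"
    by (simp add: n_def add_nonneg_pos)
  then have r: "r > 0" "r * n = \<epsilon> / 2"
    using \<epsilon> by (auto simp: r_def)
  have "r * norm x \<le> r * n" "r * norm y \<le> r * n"
    using r(1) by (auto simp: n_def intro!: mult_left_mono)
  then have "norm (c *s x) \<le> \<epsilon> / 2" "norm (c *s y) \<le> \<epsilon> / 2"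
    using r by (simp_all add: norm_vector_smult c_def)
  then have "directional_derivative a (c *s x + c *s y) =
      directional_derivative a (c *s x) + directional_derivative a (c *s y)"
    using \<epsilon> by (intro directional_derivative_add_small[of a "\<epsilon> / 2"]) auto
  then have "c * directional_derivative a (x + y) = c * (directional_derivative a x + directional_derivative a y)"
    unfolding vector_add_ldistrib[symmetric] directional_derivative_smult[OF assms]
    by (simp only: distrib_left)
  then show ?thesis
    using r by (simp add: c_def)
qed

lemma has_derivative_directional:
  assumes "a \<in> \<Omega>"
  shows "(f has_derivative directional_derivative a) (at a)"
  unfolding has_derivative_at
proof
  have "linear (directional_derivative a)"
  proof (rule linearI)
    fix r and v :: "complex ^ 'm"
    have "r *\<^sub>R v = complex_of_real r *s v"
      unfolding vec_eq_iff vector_scaleR_component vector_smult_component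
      by (simp add: scaleR_conv_of_real)
    then show "directional_derivative a (r *\<^sub>R v) = r *\<^sub>R directional_derivative a v"
      by (simp add: directional_derivative_smult[OF assms] scaleR_conv_of_real)
  qed (rule directional_derivative_add[OF assms])
  then show "bounded_linear (directional_derivative a)"
    by (simp add: linear_conv_bounded_linear)
  obtain \<rho> where \<rho>: "\<rho> > 0" "cball a \<rho> \<subseteq> \<Omega>"
    using open_contains_cball_eq[OF open_domain] assms by blast
  show "(\<lambda>h. norm (f (a + h) - f a - directional_derivative a h) / norm h) \<midarrow>0\<rightarrow> 0"
  proof (rule Lim_null_comparison)
    have "\<forall>\<^sub>F h in at (0 :: complex ^ 'm). norm h < \<rho> / 2 \<and> h \<noteq> 0"
      using \<rho> by (auto simp: eventually_at intro!: exI[of _ "\<rho> / 2"])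
    then show "\<forall>\<^sub>F h in at 0. norm (norm (f (a + h) - f a - directional_derivative a h) / norm h)
        \<le> 2 / \<rho>\<^sup>2 * norm h"
    proof (rule eventually_mono)
      fix h :: "complex ^ 'm" assume h: "norm h < \<rho> / 2 \<and> h \<noteq> 0"
      define s where "s = complex_of_real (norm h / \<rho>)"
      define v where "v = complex_of_real (\<rho> / norm h) *s h"
      have h_eq: "s *s v = h"
        using h \<rho> by (simp add: s_def v_def vector_smult_assoc)
      have s: "norm s = norm h / \<rho>" "norm s \<le> 1/2"
        using h \<rho> by (auto simp: s_def norm_divide field_simps)
      have "norm v \<le> \<rho>"
        using h \<rho> by (simp add: v_def norm_vector_smult norm_divide)
      from directional_derivative_taylor[OF \<rho>(2) this s(2)]
      have "norm (f (a + h) - f a - directional_derivative a h) \<le> 2 * (norm h / \<rho>)\<^sup>2"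
        unfolding directional_derivative_smult[OF assms, symmetric] h_eq s(1) .
      then show "norm (norm (f (a + h) - f a - directional_derivative a h) / norm h) \<le> 2 / \<rho>\<^sup>2 * norm h"
        using h \<rho> by (simp add: field_simps power2_eq_square)
    qed
    show "((\<lambda>h :: complex ^ 'm. 2 / \<rho>\<^sup>2 * norm h) \<longlongrightarrow> 0) (at 0)"
      by (intro tendsto_eq_intros) auto
  qed
qed

lemma holomorphic: "holomorphic_Cm f \<Omega>"
  unfolding holomorphic_Cm_def
proof
  fix a assume a: "a \<in> \<Omega>"
  show "\<exists>D. (f has_derivative D) (at a within \<Omega>) \<and> (\<forall>c v. D (c *s v) = c * D v)"
    using has_derivative_at_withinI[OF has_derivative_directional[OF a]] directional_derivative_smult[OF a]
    by (intro exI[of _ "directional_derivative a"]) simp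
qed

end

theorem proposition2p4:
  fixes \<Omega> :: "(complex ^ 'm) set"
  assumes "domain_in_Cm \<Omega>" and "caratheodory_hyperbolic \<Omega>"
  shows "\<exists>\<Psi> w\<^sub>0. \<Psi> \<subseteq> schur_class \<Omega> \<and> test_functions \<Omega> \<Psi> \<and>
           w\<^sub>0 \<in> \<Omega> \<and> (\<forall>\<psi>\<in>\<Psi>. \<psi> w\<^sub>0 = 0) \<and>
           schur_agler_class \<Omega> \<Psi> = schur_class \<Omega>"
proof -
  have \<Omega>: "open \<Omega>" "connected \<Omega>" "\<Omega> \<noteq> {}"
    using assms(1) by (auto simp: domain_in_Cm_def)
  then obtain w where w: "w \<in> \<Omega>" by blast
  let ?\<Psi> = "based_schur_class \<Omega> w"
  have sub: "?\<Psi> \<subseteq> schur_class \<Omega>"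
    by (auto simp: based_schur_class_def)
  have "f \<in> schur_class \<Omega>" if f: "f \<in> schur_agler_class \<Omega> ?\<Psi>" for f
  proof -
    have "pick_on_lines \<Omega> f"
      by (intro pick_on_lines.intro \<Omega>(1) schur_agler_class_pick_on_line[OF f sub]) auto
    moreover have "norm (f z) \<le> 1" if "z \<in> \<Omega>" for z
    proof (rule schur_agler_class_bounded[OF f _ that])
      show "norm (\<psi> z) \<le> 1" if "\<psi> \<in> ?\<Psi>" "z \<in> \<Omega>" for \<psi> z
        using that sub schur_class_iff[OF \<Omega>(3), of \<psi>] by auto
    qed
    ultimately show ?thesis
      using pick_on_lines.holomorphic schur_class_iff[OF \<Omega>(3), of f] by blast
  qed
  then have "schur_agler_class \<Omega> ?\<Psi> = schur_class \<Omega>"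
    using schur_class_subset_schur_agler_class[OF w] by blast
  moreover have "test_functions \<Omega> ?\<Psi>"
    by (rule test_functions_based_schur_class) (fact \<Omega> assms w)+
  ultimately show ?thesis
    using sub w by (intro exI[of _ ?\<Psi>] exI[of _ w]) (auto simp: based_schur_class_def)
qed

end
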